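(* Let $0<q\le 2$, let $k,n$ be integers with $1\le k<n$, let $X=(X_1,\dots,X_n)$ be a symmetric $q$-stable random vector in $\mathbb{R}^n$, and let $Y=(Y_1,\dots,Y_n)$ be the symmetric $q$-stable random vector such that $(Y_1,\dots,Y_k)$ has the same distribution as $(X_1,\dots,X_k)$, $(Y_{k+1},\dots,Y_n)$ has the same distribution as $(X_{k+1},\dots,X_n)$, and $Y_i$ and $Y_j$ are independent for every $1\le i\le k$, $k+1\le j\le n$. Suppose that $0<p<n$ and that $B=(\mathbb{R}^n,\|\cdot\|)$ is a homogeneous space which embeds in $L_{-p}$ and whose norm satisfies $$\|(u,v)\|=\|(u,-v)\|\qquad\text{for all }u\in\mathbb{R}^k,\ v\in\mathbb{R}^{n-k}.$$ Then $$\mathbb{E}\big(\|X\|^{-p}\big)\ \ge\ \mathbb{E}\big(\|Y\|^{-p}\big).$$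
   Context: Symmetric $q$-stable vector: $X$ is a symmetric $q$-stable random vector in $\mathbb{R}^n$ ($0<q\le 2$) if its characteristic functional has the form $\phi(\xi)=\exp\big(-\|\sum_{i=1}^n\xi_is_i\|_q^q\big)$, $\xi\in\mathbb{R}^n$, for some real-valued $s_1,\dots,s_n\in L_q([0,1])$, where $\|s\|_q^q=\int_0^1|s|^q$. With this notation the vector $Y$ has characteristic functional $\phi_0(\xi)=\exp\big(-\|\sum_{i=1}^k\xi_is_i\|_q^q-\|\sum_{i=k+1}^n\xi_is_i\|_q^q\big)$. Expectations of the non-negative quantities are understood in $[0,+\infty]$, with $0^{-p}=+\infty$. A homogeneous $n$-dimensional space $B=(\mathbb{R}^n,\|\cdot\|)$ is $\mathbb{R}^n$ together with a continuous function $x\mapsto\|x\|$ that is homogeneous of degree 1 ($\|tx\|=|t|\,\|x\|$ for all $t\in\mathbb{R}$, $x\in\mathbb{R}^n$) and positive outside the origin. Embedding in $L_{-p}$: let $\Omega$ be the Euclidean unit sphere in $\mathbb{R}^n$ and let test functions be elements of the Schwartz space $\mathcal{S}(\mathbb{R}^n)$, with $\hat\phi(\xi)=\int_{\mathbb{R}^n}\phi(x)e^{-i(x,\xi)}\,dx$. For $p\in(0,n)$, $B$ embeds in $L_{-p}$ if there exists a finite (non-negative) symmetric Borel measure $\gamma$ on $\Omega$ such that for every test function $\phi$ $$\int_{\mathbb{R}^n}\|x\|^{-p}\phi(x)\,dx=\int_\Omega d\gamma(\xi)\int_{\mathbb{R}}|t|^{p-1}\hat\phi(t\xi)\,dt .$$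 *)

theory Defs
  imports "HOL-Probability.Probability"
begin

section \<open>Splitting the coordinates of a vector\<close>

text \<open>The space \<open>\<real>\<^sup>n\<close> split as \<open>\<real>\<^sup>k \<times> \<real>\<^sup>n\<^sup>-\<^sup>k\<close> is rendered as
  \<^typ>\<open>real ^ ('k::finite + 'm::finite)\<close>: the indices \<open>Inl _\<close> are the first \<open>k = CARD('k)\<close> coordinates and the
  indices \<open>Inr _\<close> the last \<open>n - k = CARD('m)\<close>. Both blocks are nonempty because types are.\<close>

definition fst_coords :: "real ^ ('k::finite + 'm::finite) \<Rightarrow> real ^ 'k" where
  "fst_coords x = (\<chi> i. x $ Inl i)"

definition snd_coords :: "real ^ ('k::finite + 'm::finite) \<Rightarrow> real ^ 'm" where
  "snd_coords x = (\<chi> j. x $ Inr j)"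

definition join_coords :: "real ^ 'k \<Rightarrow> real ^ 'm \<Rightarrow> real ^ ('k::finite + 'm::finite)" where
  "join_coords u v = (\<chi> l. case l of Inl i \<Rightarrow> u $ i | Inr j \<Rightarrow> v $ j)"


section \<open>Symmetric stable random vectors\<close>

definition in_Lq :: "real \<Rightarrow> (real \<Rightarrow> real) \<Rightarrow> bool" where
  "in_Lq q s \<longleftrightarrow> s \<in> borel_measurable (lebesgue_on {0..1}) \<and>
     integrable (lebesgue_on {0..1}) (\<lambda>x. \<bar>s x\<bar> powr q)"

text \<open>This is \<open>\<parallel>s\<parallel>\<^sub>q\<^sup>q\<close>, i.e. without the \<open>q\<close>-th root.\<close>

definition Lq_norm_pow :: "real \<Rightarrow> (real \<Rightarrow> real) \<Rightarrow> real" where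
  "Lq_norm_pow q s = (LINT x | lebesgue_on {0..1}. \<bar>s x\<bar> powr q)"

definition char_functional :: "'a measure \<Rightarrow> ('a \<Rightarrow> real ^ 'n) \<Rightarrow> real ^ 'n \<Rightarrow> complex" where
  "char_functional M X \<xi> = (CLINT \<omega> | M. iexp (\<xi> \<bullet> X \<omega>))"

definition symmetric_stable :: "real \<Rightarrow> 'a measure \<Rightarrow> ('a \<Rightarrow> real ^ 'n) \<Rightarrow> bool" where
  "symmetric_stable q M X \<longleftrightarrow> X \<in> borel_measurable M \<and>
     (\<exists>s :: 'n \<Rightarrow> real \<Rightarrow> real. (\<forall>i. in_Lq q (s i)) \<and>
        (\<forall>\<xi>. char_functional M X \<xi> =
           complex_of_real (exp (- Lq_norm_pow q (\<lambda>x. \<Sum>i\<in>UNIV. \<xi> $ i * s i x)))))"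


section \<open>Homogeneous spaces\<close>

definition homogeneous_space :: "(real ^ 'n \<Rightarrow> real) \<Rightarrow> bool" where
  "homogeneous_space nrm \<longleftrightarrow> continuous_on UNIV nrm \<and>
     (\<forall>t x. nrm (t *\<^sub>R x) = \<bar>t\<bar> * nrm x) \<and> (\<forall>x. x \<noteq> 0 \<longrightarrow> nrm x > 0)"

text \<open>Since \<open>0 powr a = 0\<close>, the convention \<open>0\<^sup>-\<^sup>p = \<infinity>\<close> needs its own definition.\<close>

definition neg_power :: "real \<Rightarrow> real \<Rightarrow> ennreal" where
  "neg_power p r = (if r = 0 then \<infinity> else ennreal (r powr (- p)))"


section \<open>Schwartz functions and the Fourier transform\<close>

fun iter_partial :: "'n::finite list \<Rightarrow> (real ^ 'n \<Rightarrow> complex) \<Rightarrow> real ^ 'n \<Rightarrow> complex" where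
  "iter_partial [] f = f"
| "iter_partial (i # is) f = (\<lambda>x. frechet_derivative (iter_partial is f) (at x) (axis i 1))"

text \<open>Differentiability of every iterated partial derivative amounts to smoothness of \<open>f\<close>, and
  guards against the unspecified value of \<^const>\<open>frechet_derivative\<close> elsewhere.\<close>

definition schwartz :: "(real ^ 'n \<Rightarrow> complex) \<Rightarrow> bool" where
  "schwartz f \<longleftrightarrow> (\<forall>is x. iter_partial is f differentiable (at x)) \<and>
     (\<forall>is m. bounded (range (\<lambda>x. norm x ^ m *\<^sub>R iter_partial is f x)))"

definition fourier :: "(real ^ 'n \<Rightarrow> complex) \<Rightarrow> real ^ 'n \<Rightarrow> complex" where
  "fourier f \<xi> = (CLINT x | lborel. f x * iexp (- (x \<bullet> \<xi>)))"


section \<open>Embedding in \<open>L\<^sub>-\<^sub>p\<close>\<close>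

text \<open>The values of the two \<open>powr\<close> terms at \<open>x = 0\<close> and \<open>t = 0\<close> are irrelevant (null sets). For
  \<open>0 < p < n\<close> and a homogeneous space, all integrals below converge absolutely, so the value \<open>0\<close>
  of a non-integrable Bochner integral never enters.\<close>

definition embeds_in_L_neg :: "real \<Rightarrow> (real ^ 'n \<Rightarrow> real) \<Rightarrow> bool" where
  "embeds_in_L_neg p nrm \<longleftrightarrow>
     (\<exists>\<gamma> :: (real ^ 'n) measure.
        sets \<gamma> = sets (restrict_space borel (sphere 0 1)) \<and> finite_measure \<gamma> \<and>
        (\<forall>A\<in>sets \<gamma>. emeasure \<gamma> (uminus ` A) = emeasure \<gamma> A) \<and>
        (\<forall>\<phi>. schwartz \<phi> \<longrightarrow>
           (CLINT x | lborel. (nrm x powr (- p)) *\<^sub>R \<phi> x) =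
           (CLINT \<xi> | \<gamma>. CLINT t | lborel. (\<bar>t\<bar> powr (p - 1)) *\<^sub>R fourier \<phi> (t *\<^sub>R \<xi>))))"

end

theory Submission
  imports Defs
begin

text \<open>Testing the embedding identity against a Gaussian of width \<open>\<epsilon>\<close> centred at \<open>y\<close> and integrating
  \<open>y\<close> over the law of \<open>X\<close> gives, with \<open>G\<close> a standard Gaussian vector independent of \<open>X\<close>,
  \<open>E \<parallel>X + \<epsilon>G\<parallel>\<^sup>-\<^sup>p = \<integral> d\<gamma>(\<xi>) \<integral> \<bar>t\<bar>\<^sup>p\<^sup>-\<^sup>1 exp(-\<epsilon>\<^sup>2t\<^sup>2/2) \<phi>(t\<xi>) dt\<close>, where \<open>\<phi>\<close> is the characteristic functional of \<open>X\<close>.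
  By the symmetry of the norm the left side does not change when the second block of \<open>X\<close> changes
  sign, so \<open>\<phi>(u,v)\<close> may be replaced by the average of \<open>\<phi>(u,v)\<close> and \<open>\<phi>(u,-v)\<close>. Convexity of \<open>exp\<close> and
  \<open>\<parallel>a+b\<parallel>\<^sub>q\<^sup>q + \<parallel>a-b\<parallel>\<^sub>q\<^sup>q \<le> 2(\<parallel>a\<parallel>\<^sub>q\<^sup>q + \<parallel>b\<parallel>\<^sub>q\<^sup>q)\<close> show that this average dominates \<open>\<phi>(u,0) \<phi>(0,v)\<close>, which is
  the characteristic functional of \<open>Y\<close> (pairwise independence of stable coordinates forces the
  blocks to be independent). As \<open>\<epsilon> \<rightarrow> 0\<close>, use Fatou's lemma for \<open>Y\<close> and, for \<open>X\<close>, dominated convergence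
  based on \<open>E \<parallel>y + \<epsilon>G\<parallel>\<^sup>-\<^sup>p \<le> C \<parallel>y\<parallel>\<^sup>-\<^sup>p\<close>.\<close>

section \<open>Stable vectors and the parallelogram inequality in \<open>L\<^sub>q\<close>\<close>

lemma sum_UNIV_Plus:
  fixes f :: "'a::finite + 'b::finite \<Rightarrow> real"
  shows "(\<Sum>l\<in>UNIV. f l) = (\<Sum>i\<in>UNIV. f (Inl i)) + (\<Sum>j\<in>UNIV. f (Inr j))"
  using sum.Plus[of "UNIV :: 'a set" "UNIV :: 'b set" f] by simp

text \<open>Write the power as \<open>(s + t) powr (r - 1)\<close> times \<open>s + t\<close>. Since
  \<open>r - 1 < 0\<close>, the first factor is strictly smaller than both
  \<open>s powr (r - 1)\<close> and \<open>t powr (r - 1)\<close>.\<close>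

lemma powr_add_less:
  fixes s t r :: real
  assumes "0 < s" "0 < t" "r < 1"
  shows "(s + t) powr r < s powr r + t powr r"
proof -
  have *: "x powr r = x powr (r - 1) * x" if "0 < x" for x :: real
    using powr_add[of x "r - 1" 1] that by simp
  have "(s + t) powr r = (s + t) powr (r - 1) * s + (s + t) powr (r - 1) * t"
    using *[of "s + t"] assms by (simp add: algebra_simps)
  also have "\<dots> < s powr (r - 1) * s + t powr (r - 1) * t"
    using assms by (intro add_strict_mono mult_strict_right_mono powr_less_mono2_neg) auto
  also have "\<dots> = s powr r + t powr r"
    using *[of s] *[of t] assms by simp
  finally show ?thesis .
qed

lemma powr_add_le:
  fixes s t r :: real
  assumes "0 \<le> s" "0 \<le> t" "0 < r" "r \<le> 1"
  shows "(s + t) powr r \<le> s powr r + t powr r"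
proof (cases "s = 0 \<or> t = 0 \<or> r = 1")
  case False
  then show ?thesis
    using powr_add_less[of s t r] assms by simp
qed (use assms in auto)

text \<open>Concavity through the tangent at the midpoint \<open>m\<close>: adding the tangent
  bounds at \<open>a\<close> and \<open>b\<close> leaves twice the value at
  \<open>m\<close>.\<close>

lemma powr_midpoint_concave:
  fixes a b r :: real
  assumes "0 \<le> a" "0 \<le> b" "0 < r" "r \<le> 1"
  shows "a powr r + b powr r \<le> 2 * ((a + b) / 2) powr r"
proof (cases "a + b = 0")
  case True
  then have "a = 0" "b = 0"
    using assms by linarith+
  then show ?thesis by simp
next
  case False
  define m where "m = (a + b) / 2"
  have m: "0 < m"
    using False assms by (auto simp: m_def)
  \<comment> \<open>Tangent line at \<open>m\<close>: Young's inequality with weights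
    \<open>r\<close> and \<open>1 - r\<close> for the numbers \<open>x / m\<close> and
    \<open>1\<close>, multiplied by \<open>m powr r\<close>.\<close>
  have *: "x powr r \<le> m powr r * (r * (x / m) + (1 - r))" if "0 \<le> x" for x
  proof (cases "x = 0")
    case False
    have "(x / m) powr r * 1 powr (1 - r) \<le> r * (x / m) + (1 - r) * 1"
      using False m assms that by (intro Youngs_inequality_0) auto
    then have "m powr r * (x / m) powr r \<le> m powr r * (r * (x / m) + (1 - r))"
      using m by (intro mult_left_mono) auto
    then show ?thesis
      using m that by (simp add: powr_divide)
  qed (use assms in auto)
  have "a powr r + b powr r \<le> m powr r * (r * (a / m) + (1 - r)) + m powr r * (r * (b / m) + (1 - r))"
    using *[of a] *[of b] assms by simp
  also have "\<dots> = m powr r * (r * ((a + b) / m) + 2 * (1 - r))"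
    by (simp add: algebra_simps add_divide_distrib)
  also have "(a + b) / m = 2"
    using m by (simp add: m_def field_simps)
  finally show ?thesis
    by (simp add: m_def algebra_simps)
qed

lemma abs_powr_eq: "\<bar>x\<bar> powr q = (x\<^sup>2) powr (q / 2)" for x q :: real
proof (cases "x = 0")
  case False
  then have "x\<^sup>2 = \<bar>x\<bar> powr 2"
    by (simp add: powr_numeral)
  then show ?thesis
    by (simp only: powr_powr) simp
qed simp

text \<open>The squares of \<open>a + b\<close> and \<open>a - b\<close> have mean
  \<open>a\<^sup>2 + b\<^sup>2\<close>, so concavity of the power \<open>q / 2\<close> applies.
  Stopping here lets the weak and the strict parallelogram inequality differ only in the
  subadditivity of that power.\<close>

lemma abs_powr_parallelogram_aux:
  fixes a b q :: real
  assumes "0 < q" "q \<le> 2"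
  shows "\<bar>a + b\<bar> powr q + \<bar>a - b\<bar> powr q \<le> 2 * (a\<^sup>2 + b\<^sup>2) powr (q / 2)"
proof -
  have "((a + b)\<^sup>2 + (a - b)\<^sup>2) / 2 = a\<^sup>2 + b\<^sup>2"
    by (simp add: power2_eq_square algebra_simps)
  then show ?thesis
    using powr_midpoint_concave[of "(a + b)\<^sup>2" "(a - b)\<^sup>2" "q / 2"] assms
    by (simp only: abs_powr_eq) simp
qed

lemma abs_powr_parallelogram:
  fixes a b q :: real
  assumes "0 < q" "q \<le> 2"
  shows "\<bar>a + b\<bar> powr q + \<bar>a - b\<bar> powr q \<le> 2 * (\<bar>a\<bar> powr q + \<bar>b\<bar> powr q)"
  using abs_powr_parallelogram_aux[OF assms, of a b] powr_add_le[of "a\<^sup>2" "b\<^sup>2" "q / 2"] assms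
  by (simp add: abs_powr_eq)

text \<open>Strictness comes from \<open>powr_add_less\<close>, where the exponent
  \<open>q / 2\<close> is below 1; at \<open>q = 2\<close> the inequality turns into the
  parallelogram identity.\<close>

lemma abs_powr_parallelogram_strict:
  fixes a b q :: real
  assumes "0 < q" "q < 2" "a \<noteq> 0" "b \<noteq> 0"
  shows "\<bar>a + b\<bar> powr q + \<bar>a - b\<bar> powr q < 2 * (\<bar>a\<bar> powr q + \<bar>b\<bar> powr q)"
  using abs_powr_parallelogram_aux[of q a b] powr_add_less[of "a\<^sup>2" "b\<^sup>2" "q / 2"] assms
  by (simp add: abs_powr_eq)

section \<open>The class \<open>L_q\<close> on the unit interval\<close>

lemma in_Lq_scale:
  assumes "in_Lq q f"
  shows "in_Lq q (\<lambda>x. c * f x)"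
  using assms by (auto simp: in_Lq_def abs_mult powr_mult)

lemma in_Lq_add:
  assumes q: "0 < q" "q \<le> 2" and f: "in_Lq q f" and g: "in_Lq q g"
  shows "in_Lq q (\<lambda>x. f x + g x)"
proof -
  have m[measurable]: "f \<in> borel_measurable (lebesgue_on {0..1})" "g \<in> borel_measurable (lebesgue_on {0..1})"
    using f g by (auto simp: in_Lq_def)
  have "integrable (lebesgue_on {0..1}) (\<lambda>x. \<bar>f x + g x\<bar> powr q)"
  proof (rule Bochner_Integration.integrable_bound)
    show "integrable (lebesgue_on {0..1}) (\<lambda>x. 2 * (\<bar>f x\<bar> powr q + \<bar>g x\<bar> powr q))"
      using f g by (auto simp: in_Lq_def)
    \<comment> \<open>Dropping one term of the parallelogram inequality gives a majorant that also
      covers \<open>q < 1\<close>, where Minkowski's inequality fails.\<close>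
    have "\<bar>a + b\<bar> powr q \<le> 2 * (\<bar>a\<bar> powr q + \<bar>b\<bar> powr q)" for a b :: real
      using abs_powr_parallelogram[OF q, of a b] powr_ge_zero[of "\<bar>a - b\<bar>" q] by linarith
    then show "AE x in lebesgue_on {0..1}. norm (\<bar>f x + g x\<bar> powr q) \<le> norm (2 * (\<bar>f x\<bar> powr q + \<bar>g x\<bar> powr q))"
      by (auto simp: abs_of_nonneg)
  qed measurable
  then show ?thesis
    by (simp add: in_Lq_def)
qed

lemma in_Lq_diff:
  assumes "0 < q" "q \<le> 2" "in_Lq q f" "in_Lq q g"
  shows "in_Lq q (\<lambda>x. f x - g x)"
  using in_Lq_add[OF assms(1-3) in_Lq_scale[OF assms(4), of "-1"]] by simp

lemma in_Lq_sum:
  assumes "0 < q" "q \<le> 2" "finite I" "\<And>i. i \<in> I \<Longrightarrow> in_Lq q (f i)"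
  shows "in_Lq q (\<lambda>x. \<Sum>i\<in>I. f i x)"
  using assms(3,4)
proof (induction I)
  case empty
  then show ?case by (simp add: in_Lq_def)
next
  case (insert i I)
  then show ?case using in_Lq_add[OF assms(1,2), of "f i" "\<lambda>x. \<Sum>i\<in>I. f i x"] by simp
qed

lemma in_Lq_lincomb:
  fixes s :: "'i::finite \<Rightarrow> real \<Rightarrow> real"
  assumes "0 < q" "q \<le> 2" "\<And>i. in_Lq q (s i)"
  shows "in_Lq q (\<lambda>x. \<Sum>i\<in>UNIV. c i * s i x)"
  by (intro in_Lq_sum assms(1,2) finite in_Lq_scale assms(3))

lemma Lq_norm_pow_minus: "Lq_norm_pow q (\<lambda>x. - f x) = Lq_norm_pow q f"
  by (simp add: Lq_norm_pow_def)

lemma Lq_norm_pow_parallelogram: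
  assumes q: "0 < q" "q \<le> 2" and f: "in_Lq q f" and g: "in_Lq q g"
  shows "Lq_norm_pow q (\<lambda>x. f x + g x) + Lq_norm_pow q (\<lambda>x. f x - g x)
    \<le> 2 * (Lq_norm_pow q f + Lq_norm_pow q g)"
proof -
  note fg = in_Lq_add[OF q f g] in_Lq_diff[OF q f g] f g
  have "(LINT x|lebesgue_on {0..1}. \<bar>f x + g x\<bar> powr q + \<bar>f x - g x\<bar> powr q)
    \<le> (LINT x|lebesgue_on {0..1}. 2 * (\<bar>f x\<bar> powr q + \<bar>g x\<bar> powr q))"
    using fg abs_powr_parallelogram[OF q]
    by (intro integral_mono) (auto simp: in_Lq_def)
  then show ?thesis
    using fg by (simp add: Lq_norm_pow_def in_Lq_def)
qed

text \<open>The pointwise defect in the parallelogram inequality is non-negative with integral zero,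
  hence vanishes almost everywhere; strictness for \<open>q < 2\<close> then keeps
  \<open>f x\<close> and \<open>g x\<close> from being both nonzero.\<close>

lemma Lq_parallelogram_eq_imp_disjoint:
  assumes q: "0 < q" "q < 2" and f: "in_Lq q f" and g: "in_Lq q g"
    and eq: "Lq_norm_pow q (\<lambda>x. f x + g x) + Lq_norm_pow q (\<lambda>x. f x - g x)
      = 2 * (Lq_norm_pow q f + Lq_norm_pow q g)"
  shows "AE x in lebesgue_on {0..1}. f x * g x = 0"
proof -
  have q': "q \<le> 2" using q by simp
  note fg = in_Lq_add[OF q(1) q' f g] in_Lq_diff[OF q(1) q' f g] f g
  let ?d = "\<lambda>x. 2 * (\<bar>f x\<bar> powr q + \<bar>g x\<bar> powr q) - (\<bar>f x + g x\<bar> powr q + \<bar>f x - g x\<bar> powr q)"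
  have "integrable (lebesgue_on {0..1}) ?d"
    using fg by (auto simp: in_Lq_def)
  moreover have "integral\<^sup>L (lebesgue_on {0..1}) ?d = 0"
    using fg eq by (simp add: Lq_norm_pow_def in_Lq_def)
  moreover have "AE x in lebesgue_on {0..1}. 0 \<le> ?d x"
    using abs_powr_parallelogram[OF q(1) q'] by simp
  ultimately have "AE x in lebesgue_on {0..1}. ?d x = 0"
    using integral_nonneg_eq_0_iff_AE by blast
  then show ?thesis
  proof eventually_elim
    case (elim x)
    then show ?case
      using abs_powr_parallelogram_strict[OF q, of "f x" "g x"] by force
  qed
qed

lemma abs_powr_2: "\<bar>x\<bar> powr 2 = x * x" for x :: real
  by (simp add: abs_powr_eq power2_eq_square)

lemma in_Lq_2_integrable_mult:
  assumes f: "in_Lq 2 f" and g: "in_Lq 2 g"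
  shows "integrable (lebesgue_on {0..1}) (\<lambda>x. f x * g x)"
proof -
  \<comment> \<open>Polarisation reduces the product to the squares of \<open>f + g\<close> and
    \<open>f - g\<close>, which are integrable.\<close>
  have "(\<lambda>x. f x * g x) = (\<lambda>x. (\<bar>f x + g x\<bar> powr 2 - \<bar>f x - g x\<bar> powr 2) / 4)"
    by (auto simp: fun_eq_iff abs_powr_2 algebra_simps)
  then show ?thesis
    using in_Lq_add[OF _ _ f g] in_Lq_diff[OF _ _ f g] by (auto simp: in_Lq_def)
qed

lemma Lq_norm_pow_2_add:
  assumes f: "in_Lq 2 f" and g: "in_Lq 2 g"
  shows "Lq_norm_pow 2 (\<lambda>x. f x + g x) = Lq_norm_pow 2 f + Lq_norm_pow 2 g
    + 2 * (LINT x|lebesgue_on {0..1}. f x * g x)"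
proof -
  have *: "\<bar>a + b\<bar> powr 2 = \<bar>a\<bar> powr 2 + \<bar>b\<bar> powr 2 + 2 * (a * b)" for a b :: real
    by (simp add: abs_powr_2 algebra_simps)
  show ?thesis
    unfolding Lq_norm_pow_def *
    using f g in_Lq_2_integrable_mult[OF f g] by (simp add: in_Lq_def)
qed

lemma Lq_norm_pow_add_of_disjoint:
  assumes f: "in_Lq q f" and g: "in_Lq q g"
    and "AE x in lebesgue_on {0..1}. f x * g x = 0"
  shows "Lq_norm_pow q (\<lambda>x. f x + g x) = Lq_norm_pow q f + Lq_norm_pow q g"
proof -
  have "Lq_norm_pow q (\<lambda>x. f x + g x) = (LINT x|lebesgue_on {0..1}. \<bar>f x\<bar> powr q + \<bar>g x\<bar> powr q)"
    unfolding Lq_norm_pow_def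
    using assms by (intro integral_cong_AE) (auto simp: in_Lq_def elim!: eventually_mono)
  then show ?thesis
    using f g by (simp add: Lq_norm_pow_def in_Lq_def)
qed

text \<open>Pairwise additivity propagates to linear combinations: for \<open>q < 2\<close> because equality in
  the parallelogram inequality forces disjoint supports, for \<open>q = 2\<close> by bilinearity.\<close>

lemma Lq_norm_pow_block_add:
  fixes s :: "'i::finite \<Rightarrow> real \<Rightarrow> real" and t :: "'j::finite \<Rightarrow> real \<Rightarrow> real"
  assumes q: "0 < q" "q \<le> 2" and s: "\<And>i. in_Lq q (s i)" and t: "\<And>j. in_Lq q (t j)"
    and plus: "\<And>i j. Lq_norm_pow q (\<lambda>x. s i x + t j x) = Lq_norm_pow q (s i) + Lq_norm_pow q (t j)"
    and minus: "\<And>i j. Lq_norm_pow q (\<lambda>x. s i x - t j x) = Lq_norm_pow q (s i) + Lq_norm_pow q (t j)"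
  shows "Lq_norm_pow q (\<lambda>x. (\<Sum>i\<in>UNIV. c i * s i x) + (\<Sum>j\<in>UNIV. d j * t j x))
    = Lq_norm_pow q (\<lambda>x. \<Sum>i\<in>UNIV. c i * s i x) + Lq_norm_pow q (\<lambda>x. \<Sum>j\<in>UNIV. d j * t j x)"
proof -
  note S = in_Lq_lincomb[OF q s, of c] and T = in_Lq_lincomb[OF q t, of d]
  have prod: "(\<Sum>i\<in>UNIV. c i * s i x) * (\<Sum>j\<in>UNIV. d j * t j x)
    = (\<Sum>i\<in>UNIV. \<Sum>j\<in>UNIV. c i * d j * (s i x * t j x))" for x
    by (simp add: sum_product algebra_simps)
  show ?thesis
  proof (cases "q = 2")
    case False
    have "AE x in lebesgue_on {0..1}. s i x * t j x = 0" for i j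
      using False q plus[of i j] minus[of i j]
      by (intro Lq_parallelogram_eq_imp_disjoint[OF _ _ s t]) auto
    then have "AE x in lebesgue_on {0..1}. \<forall>i\<in>UNIV. \<forall>j\<in>UNIV. s i x * t j x = 0"
      by (intro AE_finite_allI) auto
    then have "AE x in lebesgue_on {0..1}. (\<Sum>i\<in>UNIV. c i * s i x) * (\<Sum>j\<in>UNIV. d j * t j x) = 0"
      unfolding prod by eventually_elim (auto intro!: sum.neutral)
    then show ?thesis
      by (rule Lq_norm_pow_add_of_disjoint[OF S T])
  next
    case True
    note s = s[unfolded True] and t = t[unfolded True]
    have "(LINT x|lebesgue_on {0..1}. s i x * t j x) = 0" for i j
      using Lq_norm_pow_2_add[OF s t, of i j] plus[of i j] True by simp
    then have "(LINT x|lebesgue_on {0..1}. (\<Sum>i\<in>UNIV. c i * s i x) * (\<Sum>j\<in>UNIV. d j * t j x)) = 0"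
      unfolding prod by (simp add: in_Lq_2_integrable_mult[OF s t])
    then show ?thesis
      using Lq_norm_pow_2_add[OF S[unfolded True] T[unfolded True]] True by simp
  qed
qed

section \<open>Characteristic functionals and blocks of coordinates\<close>

lemma (in prob_space) indep_var_char_add:
  assumes "indep_var borel U borel V"
  shows "(CLINT \<omega>|M. iexp (a * U \<omega> + b * V \<omega>))
    = (CLINT \<omega>|M. iexp (a * U \<omega>)) * (CLINT \<omega>|M. iexp (b * V \<omega>))"
proof -
  have [measurable]: "U \<in> borel_measurable M" "V \<in> borel_measurable M"
    using indep_var_rv1[OF assms] indep_var_rv2[OF assms] by auto
  have "indep_var borel ((\<lambda>x. iexp (a * x)) \<circ> U) borel ((\<lambda>x. iexp (b * x)) \<circ> V)"
    using assms by (rule indep_var_compose) measurable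
  then have "indep_var borel (\<lambda>\<omega>. iexp (a * U \<omega>)) borel (\<lambda>\<omega>. iexp (b * V \<omega>))"
    by (simp add: comp_def)
  then have "(CLINT \<omega>|M. iexp (a * U \<omega>) * iexp (b * V \<omega>))
    = (CLINT \<omega>|M. iexp (a * U \<omega>)) * (CLINT \<omega>|M. iexp (b * V \<omega>))"
    by (rule indep_var_lebesgue_integral) (auto intro!: integrable_const_bound[of _ 1])
  then show ?thesis
    by (simp add: exp_add distrib_left)
qed

text \<open>Independence of one coordinate from each block makes the \<open>L_q\<close> functional
  additive on that pair; \<open>Lq_norm_pow_block_add\<close> extends the additivity to arbitrary
  combinations of the blocks, and exponentiating gives the factorisation.\<close>

lemma stable_block_independence:
  fixes Y :: "'b \<Rightarrow> real ^ ('k::finite + 'm::finite)"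
  assumes q: "0 < q" "q \<le> 2" and N: "prob_space N"
    and s: "\<And>l. in_Lq q (s l)"
    and char: "\<And>\<xi>. char_functional N Y \<xi>
      = complex_of_real (exp (- Lq_norm_pow q (\<lambda>x. \<Sum>l\<in>UNIV. \<xi> $ l * s l x)))"
    and indep: "\<And>i j. prob_space.indep_var N borel (\<lambda>\<omega>. Y \<omega> $ Inl i) borel (\<lambda>\<omega>. Y \<omega> $ Inr j)"
  shows "char_functional N Y (join_coords u v)
    = char_functional N Y (join_coords u 0) * char_functional N Y (join_coords 0 v)"
proof -
  interpret N: prob_space N by fact
  have pair: "Lq_norm_pow q (\<lambda>x. s (Inl i) x + b * s (Inr j) x)
    = Lq_norm_pow q (s (Inl i)) + Lq_norm_pow q (\<lambda>x. b * s (Inr j) x)" for i j b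
  proof -
    \<comment> \<open>Supported on one index of each block, so that
      \<open>\<xi> a b \<bullet> Y \<omega>\<close> involves a single independent pair.\<close>
    define \<xi> :: "real \<Rightarrow> real \<Rightarrow> real ^ ('k + 'm)" where "\<xi> = (\<lambda>a b. a *\<^sub>R axis (Inl i) 1 + b *\<^sub>R axis (Inr j) 1)"
    have "(\<Sum>l\<in>UNIV. \<xi> a b $ l * s l x) = a * s (Inl i) x + b * s (Inr j) x" for a b x
      by (simp add: \<xi>_def axis_def distrib_right sum.distrib if_distrib[of "\<lambda>z. _ * z"]
            if_distrib[of "\<lambda>z. z * _"] cong: if_cong)
    then have 1: "char_functional N Y (\<xi> a b)
      = complex_of_real (exp (- Lq_norm_pow q (\<lambda>x. a * s (Inl i) x + b * s (Inr j) x)))" for a b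
      by (simp add: char)
    have "\<xi> a b \<bullet> y = a * y $ Inl i + b * y $ Inr j" for a b y
      by (simp add: \<xi>_def inner_add_left inner_axis')
    then have "char_functional N Y (\<xi> 1 b) = char_functional N Y (\<xi> 1 0) * char_functional N Y (\<xi> 0 b)"
      using N.indep_var_char_add[OF indep, of 1 i b j] by (simp add: char_functional_def)
    then have "exp (- Lq_norm_pow q (\<lambda>x. s (Inl i) x + b * s (Inr j) x))
      = exp (- Lq_norm_pow q (s (Inl i))) * exp (- Lq_norm_pow q (\<lambda>x. b * s (Inr j) x))"
      unfolding 1 of_real_mult[symmetric] of_real_eq_iff by simp
    then show ?thesis
      by (simp flip: exp_add)
  qed
  have sum_join: "(\<Sum>l\<in>UNIV. join_coords u v $ l * s l x)
    = (\<Sum>i\<in>UNIV. u $ i * s (Inl i) x) + (\<Sum>j\<in>UNIV. v $ j * s (Inr j) x)" for u v x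
    by (simp add: sum_UNIV_Plus join_coords_def)
  have "Lq_norm_pow q (\<lambda>x. (\<Sum>i\<in>UNIV. u $ i * s (Inl i) x) + (\<Sum>j\<in>UNIV. v $ j * s (Inr j) x))
    = Lq_norm_pow q (\<lambda>x. \<Sum>i\<in>UNIV. u $ i * s (Inl i) x)
      + Lq_norm_pow q (\<lambda>x. \<Sum>j\<in>UNIV. v $ j * s (Inr j) x)"
  proof (rule Lq_norm_pow_block_add[OF q s s])
    \<comment> \<open>The choices \<open>b = 1\<close> and \<open>b = -1\<close> supply both signs,
      hence equality in the parallelogram inequality.\<close>
    fix i j
    show "Lq_norm_pow q (\<lambda>x. s (Inl i) x + s (Inr j) x) = Lq_norm_pow q (s (Inl i)) + Lq_norm_pow q (s (Inr j))"
      using pair[of i 1 j] by simp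
    show "Lq_norm_pow q (\<lambda>x. s (Inl i) x - s (Inr j) x) = Lq_norm_pow q (s (Inl i)) + Lq_norm_pow q (s (Inr j))"
      using pair[of i "-1" j] by (simp add: Lq_norm_pow_minus)
  qed
  then show ?thesis
    unfolding char sum_join by (simp flip: exp_add of_real_mult)
qed

text \<open>A vector supported in one block sees only the law of that block, so equality of the
  block laws transfers these values from \<open>Y\<close> to \<open>X\<close>.\<close>

lemma char_functional_join:
  fixes X :: "'c \<Rightarrow> real ^ ('a::finite + 'b::finite)"
  assumes "X \<in> borel_measurable M"
  shows "char_functional M X (join_coords u 0) = (CLINT z|distr M borel (\<lambda>\<omega>. fst_coords (X \<omega>)). iexp (u \<bullet> z))"
    "char_functional M X (join_coords 0 v) = (CLINT z|distr M borel (\<lambda>\<omega>. snd_coords (X \<omega>)). iexp (v \<bullet> z))"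
proof -
  have [measurable]: "X \<in> borel_measurable M" by fact
  have c: "continuous_on UNIV (fst_coords :: real ^ ('a + 'b) \<Rightarrow> _)" "continuous_on UNIV (snd_coords :: real ^ ('a + 'b) \<Rightarrow> _)"
    unfolding fst_coords_def snd_coords_def by (intro continuous_intros)+
  have [measurable]: "(fst_coords :: real ^ ('a + 'b) \<Rightarrow> _) \<in> borel_measurable borel"
     "(snd_coords :: real ^ ('a + 'b) \<Rightarrow> _) \<in> borel_measurable borel"
    by (intro borel_measurable_continuous_onI c)+
  have "join_coords u 0 \<bullet> x = u \<bullet> fst_coords x" "join_coords 0 v \<bullet> x = v \<bullet> snd_coords x" for x
    by (simp_all add: inner_vec_def sum_UNIV_Plus join_coords_def fst_coords_def snd_coords_def)
  then show "char_functional M X (join_coords u 0) = (CLINT z|distr M borel (\<lambda>\<omega>. fst_coords (X \<omega>)). iexp (u \<bullet> z))"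
    "char_functional M X (join_coords 0 v) = (CLINT z|distr M borel (\<lambda>\<omega>. snd_coords (X \<omega>)). iexp (v \<bullet> z))"
    by (simp_all add: char_functional_def integral_distr)
qed

text \<open>The arguments \<open>(u, v)\<close> and \<open>(u, -v)\<close> produce
  \<open>f + g\<close> and \<open>f - g\<close>; by the parallelogram inequality the mean of their
  exponents \<open>a\<close> and \<open>b\<close> is at most the sum of the block exponents, and
  convexity of \<open>exp\<close> does the rest.\<close>

lemma stable_char_functional_average_ge:
  fixes X :: "'a \<Rightarrow> real ^ ('k::finite + 'm::finite)"
  assumes q: "0 < q" "q \<le> 2" and X: "symmetric_stable q M X"
  shows "2 * Re (char_functional M X (join_coords u 0) * char_functional M X (join_coords 0 v))
    \<le> Re (char_functional M X (join_coords u v)) + Re (char_functional M X (join_coords u (- v)))"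
proof -
  obtain s where s: "\<And>l. in_Lq q (s l)" and char: "\<And>\<xi>. char_functional M X \<xi>
      = complex_of_real (exp (- Lq_norm_pow q (\<lambda>x. \<Sum>l\<in>UNIV. \<xi> $ l * s l x)))"
    using X by (auto simp: symmetric_stable_def)
  define f where "f = (\<lambda>x. \<Sum>i\<in>UNIV. u $ i * s (Inl i) x)"
  define g where "g = (\<lambda>x. \<Sum>j\<in>UNIV. v $ j * s (Inr j) x)"
  have fg: "in_Lq q f" "in_Lq q g"
    unfolding f_def g_def by (intro in_Lq_lincomb q s)+
  define a where "a = Lq_norm_pow q (\<lambda>x. f x + g x)"
  define b where "b = Lq_norm_pow q (\<lambda>x. f x - g x)"
  have 1: "char_functional M X (join_coords u v) = exp (- a)"
    "char_functional M X (join_coords u (- v)) = exp (- b)"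
    "char_functional M X (join_coords u 0) = exp (- Lq_norm_pow q f)"
    "char_functional M X (join_coords 0 v) = exp (- Lq_norm_pow q g)"
    by (simp_all add: char sum_UNIV_Plus join_coords_def a_def b_def f_def g_def sum_negf)
  have "exp (- Lq_norm_pow q f) * exp (- Lq_norm_pow q g) \<le> exp (- a / 2) * exp (- b / 2)"
    using Lq_norm_pow_parallelogram[OF q fg] by (simp add: a_def b_def flip: exp_add)
  \<comment> \<open>Convexity of \<open>exp\<close> in the form
    \<open>2 * x * y \<le> x\<^sup>2 + y\<^sup>2\<close>.\<close>
  also have "2 * \<dots> \<le> exp (- a / 2) * exp (- a / 2) + exp (- b / 2) * exp (- b / 2)"
    using sum_squares_bound[of "exp (- a / 2)" "exp (- b / 2)"] by (simp add: power2_eq_square algebra_simps)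
  also have "\<dots> = exp (- a) + exp (- b)"
    by (simp flip: exp_add)
  finally have "2 * (exp (- Lq_norm_pow q f) * exp (- Lq_norm_pow q g)) \<le> exp (- a) + exp (- b)"
    by simp
  then show ?thesis
    unfolding 1 by (simp flip: of_real_mult)
qed

section \<open>Gaussian test functions\<close>

text \<open>The exponential beats each power through
  \<open>(1 + x / m) ^ m \<le> exp x\<close>.\<close>

lemma polynomial_mult_exp_neg_square_bounded:
  fixes c :: real
  assumes "0 < c"
  obtains B where "0 < B" "\<And>r. 0 \<le> r \<Longrightarrow> (1 + r) ^ k * exp (- c * r\<^sup>2) \<le> B"
proof -
  \<comment> \<open>\<open>Suc k\<close> instead of \<open>k\<close> keeps the divisor
    \<open>m\<close> positive.\<close>
  define m where "m = Suc k"
  \<comment> \<open>Chosen so that \<open>A * (1 + c * r\<^sup>2 / m)\<close> expands to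
    \<open>2 * (1 + r\<^sup>2)\<close> plus non-negative terms.\<close>
  define A where "A = 2 * (1 + real m / c)"
  have A: "0 < A"
    using assms by (simp add: A_def add_pos_nonneg)
  have "(1 + r) ^ k * exp (- c * r\<^sup>2) \<le> A ^ m" if "0 \<le> r" for r
  proof -
    have "(1 + r) \<le> (1 + r)\<^sup>2"
      using that by (intro self_le_power) auto
    also have "\<dots> \<le> 2 * (1 + r\<^sup>2)"
      using sum_squares_bound[of 1 r] by (simp add: power2_eq_square algebra_simps)
    also have "\<dots> \<le> A * (1 + c * r\<^sup>2 / m)"
    proof -
      have "A * (1 + c * r\<^sup>2 / m) = 2 * (1 + r\<^sup>2 + real m / c + c * r\<^sup>2 / m)"
        using assms by (simp add: A_def field_simps m_def del: of_nat_Suc)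
      then show ?thesis
        using assms by simp
    qed
    finally have "(1 + r) ^ m \<le> (A * (1 + c * r\<^sup>2 / m)) ^ m"
      using that by (intro power_mono) auto
    also have "\<dots> = A ^ m * (1 + c * r\<^sup>2 / m) ^ m"
      by (rule power_mult_distrib)
    also have "(1 + c * r\<^sup>2 / m) ^ m \<le> exp (c * r\<^sup>2)"
      using assms by (intro exp_ge_one_plus_x_over_n_power_n) (auto simp: m_def intro: order_trans[of _ 0])
    finally have "(1 + r) ^ m \<le> A ^ m * exp (c * r\<^sup>2)"
      using A by (simp add: mult_left_mono)
    moreover have "(1 + r) ^ k \<le> (1 + r) ^ m"
      using that by (intro power_increasing) (auto simp: m_def)
    ultimately show ?thesis
      by (simp add: exp_minus field_simps)
  qed
  with A that[of "A ^ m"] show thesis by simp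
qed

lemma real_polynomial_function_bound:
  fixes Q :: "'a::real_normed_vector \<Rightarrow> real"
  assumes "real_polynomial_function Q"
  shows "\<exists>C d. 0 \<le> C \<and> (\<forall>x. \<bar>Q x\<bar> \<le> C * (1 + norm x) ^ d)"
  using assms
proof induction
  case (linear f)
  then obtain C where "0 \<le> C" "\<And>x. \<bar>f x\<bar> \<le> norm x * C"
    using bounded_linear.nonneg_bounded[of f] by auto
  moreover have "norm x * C \<le> C * (1 + norm x) ^ 1" for x :: 'a
    using \<open>0 \<le> C\<close> by (simp add: algebra_simps)
  ultimately show ?case
    by (intro exI[of _ C] exI[of _ 1]) (auto intro: order_trans)
next
  case (const c)
  show ?case
    by (intro exI[of _ "\<bar>c\<bar>"] exI[of _ 0]) auto
next
  case (add f g)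
  then obtain C d C' d' where *: "0 \<le> C" "\<And>x. \<bar>f x\<bar> \<le> C * (1 + norm x) ^ d"
    "0 \<le> C'" "\<And>x. \<bar>g x\<bar> \<le> C' * (1 + norm x) ^ d'"
    by blast
  have "\<bar>f x + g x\<bar> \<le> (C + C') * (1 + norm x) ^ (max d d')" for x
  proof -
    have "\<bar>f x + g x\<bar> \<le> C * (1 + norm x) ^ d + C' * (1 + norm x) ^ d'"
      using *(2)[of x] *(4)[of x] by linarith
    also have "\<dots> \<le> C * (1 + norm x) ^ (max d d') + C' * (1 + norm x) ^ (max d d')"
      using * by (intro add_mono mult_left_mono power_increasing) auto
    finally show ?thesis by (simp add: algebra_simps)
  qed
  with * show ?case
    by (intro exI[of _ "C + C'"] exI[of _ "max d d'"]) auto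
next
  case (mult f g)
  then obtain C d C' d' where *: "0 \<le> C" "\<And>x. \<bar>f x\<bar> \<le> C * (1 + norm x) ^ d"
    "0 \<le> C'" "\<And>x. \<bar>g x\<bar> \<le> C' * (1 + norm x) ^ d'"
    by blast
  have "\<bar>f x * g x\<bar> \<le> (C * C') * (1 + norm x) ^ (d + d')" for x
    using mult_mono[OF *(2)[of x] *(4)[of x]] * by (simp add: abs_mult power_add mult_ac)
  with * show ?case
    by (intro exI[of _ "C * C'"] exI[of _ "d + d'"]) auto
qed

text \<open>Fixing the direction \<open>v\<close> keeps the derivative a scalar polynomial, so that
  differentiation can be iterated.\<close>

lemma real_polynomial_function_directional_derivative:
  fixes Q :: "'a::real_normed_vector \<Rightarrow> real"
  assumes "real_polynomial_function Q"
  shows "\<exists>Q'. real_polynomial_function Q' \<and> (\<forall>x. \<exists>D. (Q has_derivative D) (at x) \<and> D v = Q' x)"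
  using assms
proof induction
  case (linear f)
  then show ?case
    by (intro exI[of _ "\<lambda>_. f v"]) (auto intro: bounded_linear_imp_has_derivative)
next
  case (const c)
  show ?case
    by (intro exI[of _ "\<lambda>_. 0"]) (auto intro!: exI[of _ "\<lambda>_. 0"])
next
  case (add f g)
  then obtain f' g' where *: "real_polynomial_function f'" "real_polynomial_function g'"
    "\<And>x. \<exists>D. (f has_derivative D) (at x) \<and> D v = f' x"
    "\<And>x. \<exists>D. (g has_derivative D) (at x) \<and> D v = g' x"
    by blast
  have "\<exists>D. ((\<lambda>x. f x + g x) has_derivative D) (at x) \<and> D v = f' x + g' x" for x
    using *(3)[of x] *(4)[of x] by (auto intro: has_derivative_add)
  with * show ?case
    by (intro exI[of _ "\<lambda>x. f' x + g' x"]) auto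
next
  case (mult f g)
  then obtain f' g' where *: "real_polynomial_function f'" "real_polynomial_function g'"
    "\<And>x. \<exists>D. (f has_derivative D) (at x) \<and> D v = f' x"
    "\<And>x. \<exists>D. (g has_derivative D) (at x) \<and> D v = g' x"
    by blast
  have "\<exists>D. ((\<lambda>x. f x * g x) has_derivative D) (at x) \<and> D v = f x * g' x + f' x * g x" for x
    using *(3)[of x] *(4)[of x] by (auto intro!: has_derivative_mult)
  with * mult show ?case
    by (intro exI[of _ "\<lambda>x. f x * g' x + f' x * g x"]) auto
qed

lemma real_polynomial_function_inner:
  "real_polynomial_function (\<lambda>x. (x - y) \<bullet> v)"
proof -
  have "real_polynomial_function (\<lambda>x. x \<bullet> v - y \<bullet> v)"
    by (intro real_polynomial_function_diff real_polynomial_function.intros(1,2)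
        bounded_linear_inner_left)
  then show ?thesis
    by (simp add: inner_diff_left)
qed

text \<open>Polynomials times the Gaussian \<open>E\<close> form a class closed under partial
  derivatives, and polynomial growth is always absorbed by the decay of \<open>E\<close>.\<close>

lemma schwartz_gaussian:
  fixes y :: "real ^ 'n::finite"
  assumes c: "0 < c"
  shows "schwartz (\<lambda>x. complex_of_real (C * exp (- c * (norm (x - y))\<^sup>2)))"
proof -
  define E where "E = (\<lambda>x. exp (- c * (norm (x - y))\<^sup>2))"
  have dE: "(E has_derivative (\<lambda>h. E x * (- c * (2 * ((x - y) \<bullet> h))))) (at x)" for x
    unfolding E_def power2_norm_eq_inner
    by (auto intro!: derivative_eq_intros simp: inner_commute algebra_simps)
  \<comment> \<open>One differentiation: the product rule adds to \<open>Q'\<close> the product of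
    \<open>Q\<close> with the linear factor coming from the exponent of \<open>E\<close>.\<close>
  have step: "(\<forall>x. (\<lambda>x. complex_of_real (Q x * E x)) differentiable (at x)) \<and>
      (\<exists>Q'. real_polynomial_function Q' \<and>
      (\<forall>x. frechet_derivative (\<lambda>x. complex_of_real (Q x * E x)) (at x) v = complex_of_real (Q' x * E x)))"
    if Q: "real_polynomial_function Q" for Q v
  proof -
    obtain Q' where Q': "real_polynomial_function Q'"
      "\<And>x. \<exists>D. (Q has_derivative D) (at x) \<and> D v = Q' x"
      using real_polynomial_function_directional_derivative[OF Q] by blast
    let ?R = "\<lambda>x. Q' x + Q x * (- c * (2 * ((x - y) \<bullet> v)))"
    have *: "\<exists>D. ((\<lambda>x. complex_of_real (Q x * E x)) has_derivative D) (at x)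
        \<and> D v = complex_of_real (?R x * E x)" for x
    proof -
      obtain D where D: "(Q has_derivative D) (at x)" "D v = Q' x"
        using Q' by blast
      show ?thesis
        by (rule exI, rule conjI, rule has_derivative_of_real[OF has_derivative_mult[OF D(1) dE]])
          (simp add: D(2) algebra_simps)
    qed
    have "frechet_derivative (\<lambda>x. complex_of_real (Q x * E x)) (at x) v = complex_of_real (?R x * E x)" for x
      using *[of x] frechet_derivative_at by metis
    moreover have "real_polynomial_function ?R"
      by (intro real_polynomial_function.intros(2-4) Q Q' real_polynomial_function_inner)
    ultimately show ?thesis
      using * unfolding differentiable_def by blast
  qed
  have iter: "\<exists>Q. real_polynomial_function Q \<and>
      iter_partial is (\<lambda>x. complex_of_real (C * E x)) = (\<lambda>x. complex_of_real (Q x * E x))" for "is"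
  proof (induction "is")
    case Nil
    show ?case by (intro exI[of _ "\<lambda>_. C"]) auto
  next
    case (Cons i "is")
    then obtain Q where Q: "real_polynomial_function Q"
      "iter_partial is (\<lambda>x. complex_of_real (C * E x)) = (\<lambda>x. complex_of_real (Q x * E x))"
      by blast
    show ?case
      using step[OF Q(1), of "axis i 1"] Q(2) by auto
  qed
  have bnd: "bounded (range (\<lambda>x. norm x ^ m *\<^sub>R complex_of_real (Q x * E x)))"
    if Q: "real_polynomial_function Q" for Q m
  proof -
    obtain A d where A: "0 \<le> A" "\<And>x. \<bar>Q x\<bar> \<le> A * (1 + norm x) ^ d"
      using real_polynomial_function_bound[OF Q] by blast
    obtain B where B: "0 < B" "\<And>r. 0 \<le> r \<Longrightarrow> (1 + r) ^ (m + d) * exp (- c * r\<^sup>2) \<le> B"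
      using polynomial_mult_exp_neg_square_bounded[OF c, of "m + d"] by blast
    have "norm (norm x ^ m *\<^sub>R complex_of_real (Q x * E x)) \<le> A * (1 + norm y) ^ (m + d) * B" for x
    proof -
      have "norm (norm x ^ m *\<^sub>R complex_of_real (Q x * E x)) = norm x ^ m * \<bar>Q x\<bar> * E x"
        by (simp add: E_def norm_mult abs_mult del: of_real_mult)
      also have "\<dots> \<le> (1 + norm x) ^ m * (A * (1 + norm x) ^ d) * E x"
        using A by (intro mult_right_mono mult_mono power_mono) (auto simp: E_def)
      also have "\<dots> = A * ((1 + norm x) ^ (m + d) * E x)"
        by (simp add: power_add)
      \<comment> \<open>Recentring at \<open>y\<close>: growth is measured by \<open>norm x\<close>,
        but \<open>E\<close> decays in \<open>norm (x - y)\<close>.\<close>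
      also have "\<dots> \<le> A * (((1 + norm y) * (1 + norm (x - y))) ^ (m + d) * E x)"
      proof (intro mult_left_mono mult_right_mono power_mono A(1))
        have "1 + norm x \<le> 1 + norm y + norm (x - y)"
          using norm_triangle_ineq2[of x y] by simp
        also have "\<dots> \<le> (1 + norm y) * (1 + norm (x - y))"
          by (simp add: algebra_simps)
        finally show "1 + norm x \<le> (1 + norm y) * (1 + norm (x - y))" .
      qed (auto simp: E_def)
      also have "\<dots> = A * (1 + norm y) ^ (m + d) * ((1 + norm (x - y)) ^ (m + d) * exp (- c * (norm (x - y))\<^sup>2))"
        unfolding power_mult_distrib E_def by (simp add: mult_ac)
      also have "\<dots> \<le> A * (1 + norm y) ^ (m + d) * B"
        using A by (intro mult_left_mono B) auto
      finally show ?thesis .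
    qed
    then show ?thesis
      by (auto intro!: boundedI)
  qed
  have E_eq: "exp (- c * (norm (x - y))\<^sup>2) = E x" for x
    by (simp add: E_def)
  show ?thesis
    unfolding schwartz_def E_eq
  proof (intro conjI allI)
    fix "is" x m
    obtain Q where Q: "real_polynomial_function Q"
      "iter_partial is (\<lambda>x. complex_of_real (C * E x)) = (\<lambda>x. complex_of_real (Q x * E x))"
      using iter by blast
    show "iter_partial is (\<lambda>x. complex_of_real (C * E x)) differentiable at x"
      using step[OF Q(1)] Q(2) by metis
    show "bounded (range (\<lambda>x. norm x ^ m *\<^sub>R iter_partial is (\<lambda>x. complex_of_real (C * E x)) x))"
      unfolding Q(2) by (rule bnd[OF Q(1)])
  qed
qed

section \<open>The standard Gaussian measure and its rescalings\<close>

text \<open>The product form suits Fubini and the one-dimensional normal law; the radial form in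
  \<open>gauss_density_eq\<close> serves for decay and for invariance under reflections.\<close>

definition gauss_density :: "'a::euclidean_space \<Rightarrow> real" where
  "gauss_density z = (\<Prod>b\<in>Basis. std_normal_density (z \<bullet> b))"

lemma gauss_density_pos: "0 < gauss_density z"
  by (auto simp: gauss_density_def intro!: prod_pos normal_density_pos)

lemma borel_measurable_gauss_density[measurable]: "gauss_density \<in> borel_measurable borel"
  unfolding gauss_density_def by measurable

lemma gauss_density_eq:
  "gauss_density z = (1 / sqrt (2 * pi)) ^ DIM('a) * exp (- (norm z)\<^sup>2 / 2)" for z :: "'a::euclidean_space"
proof -
  have "(\<Sum>b\<in>Basis. - (z \<bullet> b)\<^sup>2 / 2) = - (norm z)\<^sup>2 / 2"
    by (simp add: norm_eq_sqrt_inner euclidean_inner[of z z] power2_eq_square sum_negf sum_divide_distrib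
        sum_nonneg)
  then show ?thesis
    by (simp only: gauss_density_def std_normal_density_def prod.distrib prod_constant exp_sum[symmetric] finite_Basis)
qed

lemma nn_integral_gauss_density: "(\<integral>\<^sup>+ z. ennreal (gauss_density z) \<partial>lborel) = 1"
proof -
  have "(\<integral>\<^sup>+ z. ennreal (gauss_density z) \<partial>(lborel :: 'a measure))
    = (\<integral>\<^sup>+ z. (\<Prod>b\<in>Basis. ennreal (std_normal_density (z \<bullet> b))) \<partial>(lborel :: 'a measure))"
    by (simp add: gauss_density_def prod_ennreal)
  also have "\<dots> = (\<Prod>b\<in>(Basis :: 'a set). \<integral>\<^sup>+ x. ennreal (std_normal_density x) \<partial>lborel)"
    by (intro nn_integral_lborel_prod) auto
  also have "(\<integral>\<^sup>+ x. ennreal (std_normal_density x) \<partial>lborel) = 1"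
    by (subst nn_integral_eq_integral) auto
  finally show ?thesis by simp
qed

lemma integral_std_normal_density_iexp:
  "(CLINT x|lborel. complex_of_real (std_normal_density x) * iexp (t * x)) = exp (- t\<^sup>2 / 2)"
proof -
  have "char std_normal_distribution t = (CLINT x|lborel. std_normal_density x *\<^sub>R iexp (t * x))"
    unfolding char_def by (subst integral_density) auto
  then show ?thesis
    by (simp add: char_std_normal_distribution scaleR_conv_of_real)
qed

lemma integral_gauss_density_iexp:
  fixes \<xi> :: "'a::euclidean_space"
  shows "(CLINT z|lborel. complex_of_real (gauss_density z) * iexp (\<xi> \<bullet> z)) = exp (- (norm \<xi>)\<^sup>2 / 2)"
proof -
  interpret product_sigma_finite "\<lambda>_::'a. lborel :: real measure" ..
  let ?f = "\<lambda>b x. complex_of_real (std_normal_density x) * iexp ((\<xi> \<bullet> b) * x)"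
  have eq: "complex_of_real (gauss_density z) * iexp (\<xi> \<bullet> z) = (\<Prod>b\<in>Basis. ?f b (z \<bullet> b))" for z
  proof -
    have "iexp (\<xi> \<bullet> z) = (\<Prod>b\<in>Basis. iexp ((\<xi> \<bullet> b) * (z \<bullet> b)))"
      by (subst euclidean_inner) (simp add: sum_distrib_left exp_sum)
    then show ?thesis
      by (simp add: gauss_density_def prod.distrib)
  qed
  have "(CLINT z|lborel. complex_of_real (gauss_density z) * iexp (\<xi> \<bullet> z))
    = (CLINT g|(\<Pi>\<^sub>M b\<in>(Basis :: 'a set). lborel). \<Prod>b\<in>Basis. ?f b (g b))"
    unfolding eq by (subst lborel_eq, subst integral_distr) simp_all
  also have "\<dots> = (\<Prod>b\<in>Basis. CLINT x|lborel. ?f b x)"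
  proof (intro product_integral_prod)
    fix b :: 'a
    have "integrable lborel (\<lambda>x. complex_of_real (std_normal_density x))"
      by simp
    then show "integrable lborel (?f b)"
      by (rule Bochner_Integration.integrable_bound) (auto simp: norm_mult)
  qed simp
  also have "\<dots> = (\<Prod>b\<in>Basis. complex_of_real (exp (- (\<xi> \<bullet> b)\<^sup>2 / 2)))"
    by (simp only: integral_std_normal_density_iexp)
  also have "\<dots> = complex_of_real (exp (\<Sum>b\<in>Basis. - (\<xi> \<bullet> b)\<^sup>2 / 2))"
    by (simp only: exp_sum[OF finite_Basis] of_real_prod)
  also have "(\<Sum>b\<in>Basis. - (\<xi> \<bullet> b)\<^sup>2 / 2) = - (norm \<xi>)\<^sup>2 / 2"
    by (simp add: norm_eq_sqrt_inner euclidean_inner[of \<xi> \<xi>] power2_eq_square sum_negf sum_divide_distrib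
        sum_nonneg)
  finally show ?thesis by simp
qed

definition std_gaussian :: "'a::euclidean_space measure" where
  "std_gaussian = density lborel (\<lambda>z. ennreal (gauss_density z))"

lemma sets_std_gaussian[measurable_cong, simp]: "sets std_gaussian = sets borel"
  by (simp add: std_gaussian_def)

lemma space_std_gaussian[simp]: "space std_gaussian = UNIV"
  by (simp add: std_gaussian_def)

lemma prob_space_std_gaussian: "prob_space std_gaussian"
  by (rule prob_spaceI) (simp add: std_gaussian_def emeasure_density nn_integral_gauss_density)

lemma AE_std_gaussian: "(AE z in std_gaussian. P z) \<longleftrightarrow> (AE z in lborel. P z)"
  unfolding std_gaussian_def by (subst AE_density) (auto simp: gauss_density_pos)

lemma char_functional_std_gaussian:
  "(CLINT z|std_gaussian. iexp (\<xi> \<bullet> z)) = exp (- (norm \<xi>)\<^sup>2 / 2)"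
  unfolding integral_gauss_density_iexp[symmetric] std_gaussian_def
  by (subst integral_density) (auto simp: less_imp_le[OF gauss_density_pos] scaleR_conv_of_real)

lemma integral_lborel_affine:
  fixes f :: "'a::euclidean_space \<Rightarrow> 'b::{banach, second_countable_topology}"
  assumes [measurable]: "f \<in> borel_measurable borel" and e: "0 < e"
  shows "integral\<^sup>L lborel f = e ^ DIM('a) *\<^sub>R (\<integral>z. f (y + e *\<^sub>R z) \<partial>lborel)"
  by (subst lborel_affine[of e y])
    (use e in \<open>simp_all add: integral_density integral_distr\<close>)

lemma nn_integral_lborel_affine:
  fixes f :: "'a::euclidean_space \<Rightarrow> ennreal"
  assumes [measurable]: "f \<in> borel_measurable borel" and e: "0 < e"
  shows "(\<integral>\<^sup>+ x. f x \<partial>lborel) = ennreal (e ^ DIM('a)) * (\<integral>\<^sup>+ z. f (y + e *\<^sub>R z) \<partial>lborel)"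
  by (subst lborel_affine[of e y])
    (use e in \<open>simp_all add: nn_integral_density nn_integral_distr nn_integral_cmult ennreal_power\<close>)

text \<open>For \<open>e > 0\<close>, the density of \<open>y + e G\<close> with \<open>G\<close>
  standard Gaussian, made complex because test functions are complex-valued.\<close>

definition gauss_kernel :: "real \<Rightarrow> 'a::euclidean_space \<Rightarrow> 'a \<Rightarrow> complex" where
  "gauss_kernel e y x = complex_of_real (gauss_density ((x - y) /\<^sub>R e) / e ^ DIM('a))"

lemma borel_measurable_gauss_kernel[measurable]: "gauss_kernel e y \<in> borel_measurable borel"
  unfolding gauss_kernel_def by measurable

lemma schwartz_gauss_kernel:
  fixes y :: "real ^ 'n::finite"
  assumes "0 < e"
  shows "schwartz (gauss_kernel e y)"
proof -
  have "gauss_kernel e y = (\<lambda>x. complex_of_real ((1 / sqrt (2 * pi)) ^ DIM(real ^ 'n) / e ^ DIM(real ^ 'n)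
    * exp (- (1 / (2 * e\<^sup>2)) * (norm (x - y))\<^sup>2)))"
    using assms by (auto simp: gauss_kernel_def gauss_density_eq power_mult_distrib power_divide divide_simps)
  then show ?thesis
    by (simp only:) (rule schwartz_gaussian, use assms in simp)
qed

lemma integral_gauss_kernel:
  fixes f :: "'a::euclidean_space \<Rightarrow> complex"
  assumes [measurable]: "f \<in> borel_measurable borel" and e: "0 < e"
  shows "(CLINT x|lborel. f x * gauss_kernel e y x) = (CLINT z|std_gaussian. f (y + e *\<^sub>R z))"
proof -
  have "(CLINT x|lborel. f x * gauss_kernel e y x)
    = e ^ DIM('a) *\<^sub>R (CLINT z|lborel. f (y + e *\<^sub>R z) * gauss_kernel e y (y + e *\<^sub>R z))"
    by (rule integral_lborel_affine[OF _ e]) measurable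
  also have "\<dots> = (CLINT z|lborel. gauss_density z *\<^sub>R f (y + e *\<^sub>R z))"
    unfolding integral_scaleR_right[symmetric]
    using e by (intro Bochner_Integration.integral_cong) (auto simp: gauss_kernel_def scaleR_conv_of_real)
  also have "\<dots> = (CLINT z|std_gaussian. f (y + e *\<^sub>R z))"
    unfolding std_gaussian_def
    by (subst integral_density) (auto simp: less_imp_le[OF gauss_density_pos])
  finally show ?thesis .
qed

text \<open>The centre \<open>y\<close> enters only through a phase, which averages to a
  characteristic functional when \<open>y\<close> is random; the width \<open>e\<close> enters only
  through a damping factor.\<close>

lemma fourier_gauss_kernel:
  fixes y :: "real ^ 'n::finite"
  assumes e: "0 < e"
  shows "fourier (gauss_kernel e y) \<eta> = iexp (- (y \<bullet> \<eta>)) * exp (- (e * norm \<eta>)\<^sup>2 / 2)"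
proof -
  have "fourier (gauss_kernel e y) \<eta> = (CLINT z|std_gaussian. iexp (- ((y + e *\<^sub>R z) \<bullet> \<eta>)))"
    unfolding fourier_def using integral_gauss_kernel[OF _ e, of "\<lambda>x. iexp (- (x \<bullet> \<eta>))" y]
    by (simp add: mult.commute)
  also have "\<dots> = (CLINT z|std_gaussian. iexp (- (y \<bullet> \<eta>)) * iexp ((- e *\<^sub>R \<eta>) \<bullet> z))"
    by (intro Bochner_Integration.integral_cong)
      (simp_all add: inner_add_left inner_commute algebra_simps flip: exp_add)
  also have "\<dots> = iexp (- (y \<bullet> \<eta>)) * exp (- (norm (- e *\<^sub>R \<eta>))\<^sup>2 / 2)"
    by (simp only: integral_mult_right_zero char_functional_std_gaussian)
  finally show ?thesis
    using e by simp
qed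

section \<open>Gaussian means of the kernel\<close>

lemma neg_power_measurable[measurable]: "neg_power p \<in> borel_measurable borel"
  unfolding neg_power_def by measurable

lemma pred_ball_measurable[measurable]:
  "Measurable.pred borel (\<lambda>x :: 'a::euclidean_space. x \<in> ball c r)"
  unfolding mem_ball by measurable

text \<open>Since \<open>inverse 0 = \<infinity>\<close> in \<open>ennreal\<close>, this absorbs the
  convention at \<open>0\<close> into a continuous function, so that
  \<open>tendsto_neg_power\<close> holds at \<open>r = 0\<close> too.\<close>

lemma neg_power_eq_inverse:
  assumes "0 < p" "0 \<le> r"
  shows "neg_power p r = inverse (ennreal (r powr p))"
  using assms by (auto simp: neg_power_def inverse_ennreal powr_minus)

lemma tendsto_neg_power:
  assumes p: "0 < p" and f: "(f \<longlongrightarrow> r) F" and nonneg: "\<And>x. 0 \<le> f x" "0 \<le> r"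
  shows "((\<lambda>x. neg_power p (f x)) \<longlongrightarrow> neg_power p r) F"
proof -
  have "continuous_on UNIV (inverse :: ennreal \<Rightarrow> ennreal)"
    by (intro continuous_on_inverse_ennreal continuous_on_id)
  then have "isCont (inverse :: ennreal \<Rightarrow> ennreal) (ennreal (r powr p))"
    by (simp add: continuous_on_eq_continuous_at)
  moreover have "((\<lambda>x. f x powr p) \<longlongrightarrow> r powr p) F"
    using p nonneg by (intro tendsto_powr' f tendsto_const) auto
  ultimately have "((\<lambda>x. inverse (ennreal (f x powr p))) \<longlongrightarrow> inverse (ennreal (r powr p))) F"
    by (intro isCont_tendsto_compose[where g = inverse] tendsto_ennrealI)
  then show ?thesis
    using p nonneg by (simp add: neg_power_eq_inverse)
qed

lemma neg_power_antimono:
  assumes "0 < p" "0 \<le> a" "a \<le> b"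
  shows "neg_power p b \<le> neg_power p a"
  using assms by (auto simp: neg_power_def intro!: ennreal_leI powr_mono2')

lemma neg_power_mult:
  assumes "0 < p" "0 < a" "0 \<le> b"
  shows "neg_power p (a * b) = ennreal (a powr - p) * neg_power p b"
  using assms by (auto simp: neg_power_def powr_mult ennreal_mult' ennreal_mult_top)

lemma has_integral_abs_powr:
  fixes a :: real
  assumes "- 1 < a"
  shows "((\<lambda>t. \<bar>t\<bar> powr a) has_integral 2 / (a + 1)) {-1..1}"
proof -
  have "((\<lambda>t. t powr a) has_integral 1 / (a + 1)) {0..1}"
    using has_integral_powr_from_0[of a 1] assms by simp
  then have 1: "((\<lambda>t. \<bar>t\<bar> powr a) has_integral 1 / (a + 1)) {0..1}"
    by (rule has_integral_eq[rotated]) auto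
  then have 2: "((\<lambda>t. \<bar>t\<bar> powr a) has_integral 1 / (a + 1)) {-1..0}"
    using has_integral_reflect_real[of "\<lambda>t. \<bar>t\<bar> powr a" "1 / (a + 1)" 1 0] by simp
  show ?thesis
    using has_integral_combine[OF _ _ 2 1] by simp
qed

lemma nn_integral_abs_powr:
  fixes a :: real
  assumes "- 1 < a"
  shows "(\<integral>\<^sup>+ t. ennreal (\<bar>t\<bar> powr a * indicator {-1..1} t) \<partial>lborel) < \<infinity>"
proof -
  have "((\<lambda>t. \<bar>t\<bar> powr a * indicator {-1..1} t) has_integral 2 / (a + 1)) UNIV"
  proof (rule has_integral_eq[rotated])
    show "((\<lambda>t. if t \<in> {-1..1} then \<bar>t\<bar> powr a else 0) has_integral 2 / (a + 1)) UNIV"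
      using has_integral_abs_powr[OF assms] by (simp only: has_integral_restrict_UNIV)
  qed auto
  then show ?thesis
    by (subst nn_integral_has_integral_lborel) auto
qed

text \<open>The radial kernel is dominated by a product of one-dimensional kernels of exponent
  \<open>p / n < 1\<close> in the coordinates.\<close>

lemma nn_integral_neg_power_norm_unit_ball:
  assumes p: "0 < p" "p < real DIM('a::euclidean_space)"
  shows "(\<integral>\<^sup>+ x. neg_power p (norm x) * indicator (ball 0 1) x \<partial>(lborel :: 'a measure)) < \<infinity>"
proof -
  define a where "a = p / DIM('a)"
  have a: "0 < a" "a < 1"
    using p by (auto simp: a_def)
  let ?g = "\<lambda>t. neg_power a \<bar>t\<bar> * indicator {-1..1} t"
  have "neg_power p (norm x) * indicator (ball 0 1) x \<le> (\<Prod>b\<in>Basis. ?g (x \<bullet> b))" if "x \<noteq> 0" for x :: 'a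
  proof (cases "norm x < 1")
    case True
    have "neg_power p (norm x) = (\<Prod>b\<in>(Basis :: 'a set). neg_power a (norm x))"
      using that a by (simp add: neg_power_def ennreal_power flip: powr_realpow) (simp add: a_def powr_powr)
    also have "\<dots> \<le> (\<Prod>b\<in>Basis. ?g (x \<bullet> b))"
    proof (rule prod_mono_ennreal)
      fix b :: 'a assume b: "b \<in> Basis"
      then have "\<bar>x \<bullet> b\<bar> \<le> norm x"
        by (rule Basis_le_norm)
      then show "neg_power a (norm x) \<le> ?g (x \<bullet> b)"
        using True a neg_power_antimono[of a "\<bar>x \<bullet> b\<bar>" "norm x"] by (auto simp: indicator_def)
    qed
    finally show ?thesis using True by simp
  qed (auto simp: dist_norm)
  then have "(\<integral>\<^sup>+ x. neg_power p (norm x) * indicator (ball 0 1) x \<partial>(lborel :: 'a measure))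
    \<le> (\<integral>\<^sup>+ x. (\<Prod>b\<in>Basis. ?g (x \<bullet> b)) \<partial>(lborel :: 'a measure))"
    using AE_lborel_singleton[of "0::'a"] by (intro nn_integral_mono_AE) auto
  also have "\<dots> = (\<Prod>b\<in>(Basis :: 'a set). \<integral>\<^sup>+ t. ?g t \<partial>lborel)"
    by (intro nn_integral_lborel_prod) auto
  also have "(\<integral>\<^sup>+ t. ?g t \<partial>lborel) = (\<integral>\<^sup>+ t. ennreal (\<bar>t\<bar> powr - a * indicator {-1..1} t) \<partial>lborel)"
    using AE_lborel_singleton[of "0::real"]
    by (intro nn_integral_cong_AE) (auto simp: neg_power_def indicator_def)
  also have "(\<Prod>b\<in>(Basis :: 'a set). \<integral>\<^sup>+ t. ennreal (\<bar>t\<bar> powr - a * indicator {-1..1} t) \<partial>lborel) < \<infinity>"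
    using nn_integral_abs_powr[of "- a"] a by (simp add: power_less_top_ennreal)
  finally show ?thesis .
qed

text \<open>Dilation by \<open>R\<close>: the Jacobian contributes \<open>R ^ DIM('a)\<close>,
  homogeneity contributes \<open>R powr - p\<close>.\<close>

lemma nn_integral_neg_power_norm_ball:
  assumes p: "0 < p" and R: "0 < R"
  shows "(\<integral>\<^sup>+ x. neg_power p (norm x) * indicator (ball 0 R) x \<partial>(lborel :: 'a::euclidean_space measure))
    = ennreal (R powr (real DIM('a) - p))
      * (\<integral>\<^sup>+ x. neg_power p (norm x) * indicator (ball 0 1) x \<partial>(lborel :: 'a measure))"
proof -
  have m: "(\<lambda>x::'a. neg_power p (norm x) * indicator (ball 0 R) x) \<in> borel_measurable borel"
    by measurable
  have "(\<integral>\<^sup>+ x. neg_power p (norm x) * indicator (ball 0 R) x \<partial>(lborel :: 'a measure))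
    = ennreal (R ^ DIM('a)) * (\<integral>\<^sup>+ x. neg_power p (norm (R *\<^sub>R x)) * indicator (ball 0 R) (R *\<^sub>R x) \<partial>(lborel :: 'a measure))"
    using nn_integral_lborel_affine[OF m R, of 0] by simp
  also have "(\<lambda>x::'a. neg_power p (norm (R *\<^sub>R x)) * indicator (ball 0 R) (R *\<^sub>R x) :: ennreal)
    = (\<lambda>x. ennreal (R powr - p) * (neg_power p (norm x) * indicator (ball 0 1) x))"
    using R p by (auto simp: fun_eq_iff neg_power_mult indicator_def mult.assoc)
  also have "(\<integral>\<^sup>+ x. ennreal (R powr - p) * (neg_power p (norm x) * indicator (ball 0 1) x) \<partial>(lborel :: 'a measure))
    = ennreal (R powr - p) * (\<integral>\<^sup>+ x. neg_power p (norm x) * indicator (ball 0 1) x \<partial>(lborel :: 'a measure))"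
    by (rule nn_integral_cmult) measurable
  finally show ?thesis
    using R by (simp add: mult.assoc[symmetric] powr_diff powr_minus powr_realpow divide_inverse ennreal_mult)
qed

section \<open>Gaussian means: finiteness, uniform bound and limit\<close>

text \<open>\<open>m\<close> and \<open>L\<close> are the extreme values on the compact unit sphere;
  homogeneity carries the bounds to all vectors.\<close>

lemma homogeneous_space_bounds:
  fixes nrm :: "real ^ 'n::finite \<Rightarrow> real"
  assumes "homogeneous_space nrm"
  obtains m L where "0 < m" "0 < L" "\<And>x. m * norm x \<le> nrm x" "\<And>x. nrm x \<le> L * norm x"
proof -
  have cont: "continuous_on UNIV nrm" and hom: "\<And>t x. nrm (t *\<^sub>R x) = \<bar>t\<bar> * nrm x"
    and pos: "\<And>x. x \<noteq> 0 \<Longrightarrow> 0 < nrm x"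
    using assms by (auto simp: homogeneous_space_def)
  let ?S = "sphere 0 1 :: (real ^ 'n) set"
  have S: "compact ?S" "?S \<noteq> {}" "continuous_on ?S nrm"
    using continuous_on_subset[OF cont] by auto
  obtain a where a: "a \<in> ?S" "\<And>x. x \<in> ?S \<Longrightarrow> nrm a \<le> nrm x"
    using continuous_attains_inf[OF S] by blast
  obtain b where b: "b \<in> ?S" "\<And>x. x \<in> ?S \<Longrightarrow> nrm x \<le> nrm b"
    using continuous_attains_sup[OF S] by blast
  have eq: "nrm x = norm x * nrm (x /\<^sub>R norm x)" if "x \<noteq> 0" for x
    using hom[of "norm x" "x /\<^sub>R norm x"] that by simp
  have mem: "x /\<^sub>R norm x \<in> ?S" if "x \<noteq> 0" for x :: "real ^ 'n"
    using that by simp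
  have zero: "nrm 0 = 0"
    using hom[of 0 0] by simp
  show thesis
  proof (rule that)
    show "0 < nrm a" "0 < nrm b"
      using a(1) b(1) by (auto intro!: pos)
    show "nrm a * norm x \<le> nrm x" "nrm x \<le> nrm b * norm x" for x
      using eq[of x] a(2)[OF mem[of x]] b(2)[OF mem[of x]]
      by (cases "x = 0"; simp add: zero mult.commute mult_left_mono)+
  qed
qed

text \<open>Kept in \<open>ennreal\<close> so that Fatou's lemma and dominated convergence apply
  directly as \<open>e\<close> tends to 0; \<open>smoothed_kernel\<close> below is the real-valued
  counterpart used with Fubini.\<close>

definition gauss_mean :: "real \<Rightarrow> (real ^ 'n::finite \<Rightarrow> real) \<Rightarrow> real \<Rightarrow> real ^ 'n \<Rightarrow> ennreal" where
  "gauss_mean p nrm e y = (\<integral>\<^sup>+ z. neg_power p (nrm (y + e *\<^sub>R z)) \<partial>std_gaussian)"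

context
  fixes nrm :: "real ^ 'n::finite \<Rightarrow> real" and p m L :: real
  assumes p: "0 < p" "p < real CARD('n)"
    and hom: "homogeneous_space nrm"
    and mL: "0 < m" "0 < L" "\<And>x. m * norm x \<le> nrm x" "\<And>x. nrm x \<le> L * norm x"
begin

lemma nrm_continuous: "continuous_on UNIV nrm"
  using hom by (simp add: homogeneous_space_def)

lemma nrm_measurable[measurable]: "nrm \<in> borel_measurable borel"
  by (rule borel_measurable_continuous_onI[OF nrm_continuous])

lemma nrm_nonneg: "0 \<le> nrm x"
  using mL(1) mL(3)[of x] by (meson mult_nonneg_nonneg norm_ge_zero order_trans less_imp_le)

lemma neg_power_nrm_le: "neg_power p (nrm x) \<le> ennreal (m powr - p) * neg_power p (norm x)"
  using neg_power_antimono[OF p(1), of "m * norm x" "nrm x"] mL neg_power_mult[OF p(1) mL(1), of "norm x"] by simp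

lemma neg_power_nrm_far_le:
  assumes r: "0 < r" and z: "r \<le> norm x"
  shows "neg_power p (nrm x) \<le> ennreal ((m * r) powr - p)"
proof -
  have "m * r \<le> nrm x"
    using mL(1) mL(3)[of x] z by (meson mult_left_mono order_trans less_imp_le)
  then have "neg_power p (nrm x) \<le> neg_power p (m * r)"
    using mL r p by (intro neg_power_antimono) auto
  then show ?thesis
    using mL r by (simp add: neg_power_def)
qed

text \<open>Where \<open>y + e *\<^sub>R z\<close> is within \<open>r\<close> of the singularity,
  the density is replaced by its bound \<open>G\<close>. Substituting
  \<open>x = y + e *\<^sub>R z\<close> then leaves the radial kernel on a ball and the Jacobian
  \<open>1 / e ^ CARD('n)\<close>.\<close>

lemma gauss_mean_near_le:
  fixes y :: "real ^ 'n"
  assumes e: "0 < e" and r: "0 < r" and G: "\<And>z. norm (y + e *\<^sub>R z) < r \<Longrightarrow> gauss_density z \<le> G"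
  shows "(\<integral>\<^sup>+ z. neg_power p (nrm (y + e *\<^sub>R z)) * indicator {z. norm (y + e *\<^sub>R z) < r} z \<partial>std_gaussian)
    \<le> ennreal (G * m powr - p * r powr (real CARD('n) - p) / e ^ CARD('n))
      * (\<integral>\<^sup>+ x. neg_power p (norm x) * indicator (ball 0 1) x \<partial>(lborel :: (real ^ 'n) measure))"
    (is "?lhs \<le> _ * ?A")
proof -
  let ?f = "\<lambda>x :: real ^ 'n. neg_power p (norm x) * indicator (ball 0 r) x :: ennreal"
  have m[measurable]: "(\<lambda>z. ?f (y + e *\<^sub>R z)) \<in> borel_measurable borel"
    by (rule measurable_compose[where g = ?f and N = borel]) measurable
  \<comment> \<open>The bound \<open>G\<close> is attached to a nonempty set:
    \<open>z = - y /\<^sub>R e\<close> hits the singularity itself.\<close>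
  have G0: "0 \<le> G"
    using G[of "- y /\<^sub>R e"] e r gauss_density_pos[of "- y /\<^sub>R e"] by (simp add: less_imp_le)
  have "?lhs = (\<integral>\<^sup>+ z. ennreal (gauss_density z) * (neg_power p (nrm (y + e *\<^sub>R z)) * indicator {z. norm (y + e *\<^sub>R z) < r} z) \<partial>lborel)"
    unfolding std_gaussian_def by (subst nn_integral_density) auto
  also have "\<dots> \<le> (\<integral>\<^sup>+ z. ennreal (G * m powr - p) * ?f (y + e *\<^sub>R z) \<partial>lborel)"
  proof (intro nn_integral_mono)
    fix z
    show "ennreal (gauss_density z) * (neg_power p (nrm (y + e *\<^sub>R z)) * indicator {z. norm (y + e *\<^sub>R z) < r} z)
      \<le> ennreal (G * m powr - p) * ?f (y + e *\<^sub>R z)"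
      using G0 mult_mono[OF ennreal_leI[OF G[of z]] neg_power_nrm_le[of "y + e *\<^sub>R z"]]
      by (auto simp: indicator_def ennreal_mult mult.assoc)
  qed
  also have "\<dots> = ennreal (G * m powr - p) * (\<integral>\<^sup>+ z. ?f (y + e *\<^sub>R z) \<partial>lborel)"
    by (rule nn_integral_cmult) measurable
  also have "(\<integral>\<^sup>+ z. ?f (y + e *\<^sub>R z) \<partial>lborel) = ennreal (1 / e ^ CARD('n)) * (\<integral>\<^sup>+ x. ?f x \<partial>lborel)"
    using e by (subst nn_integral_lborel_affine[OF _ e, of _ y])
      (simp_all add: mult.assoc[symmetric] flip: ennreal_mult)
  also have "(\<integral>\<^sup>+ x. ?f x \<partial>lborel) = ennreal (r powr (real CARD('n) - p)) * ?A"
    using nn_integral_neg_power_norm_ball[OF p(1) r, where 'a = "real ^ 'n"] by simp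
  also have "ennreal (G * m powr - p) * (ennreal (1 / e ^ CARD('n)) * (ennreal (r powr (real CARD('n) - p)) * ?A))
    = ennreal (G * m powr - p * r powr (real CARD('n) - p) / e ^ CARD('n)) * ?A"
    using e G0 by (simp add: mult.assoc[symmetric] ennreal_mult[symmetric])
  finally show ?thesis .
qed

lemma gauss_mean_split:
  "gauss_mean p nrm e y
    = (\<integral>\<^sup>+ z. neg_power p (nrm (y + e *\<^sub>R z)) * indicator {z. norm (y + e *\<^sub>R z) < r} z \<partial>std_gaussian)
    + (\<integral>\<^sup>+ z. neg_power p (nrm (y + e *\<^sub>R z)) * indicator {z. r \<le> norm (y + e *\<^sub>R z)} z \<partial>std_gaussian)"
proof -
  have "gauss_mean p nrm e y = (\<integral>\<^sup>+ z. neg_power p (nrm (y + e *\<^sub>R z)) * indicator {z. norm (y + e *\<^sub>R z) < r} z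
    + neg_power p (nrm (y + e *\<^sub>R z)) * indicator {z. r \<le> norm (y + e *\<^sub>R z)} z \<partial>std_gaussian)"
    unfolding gauss_mean_def by (intro nn_integral_cong) (auto simp: indicator_def)
  also have "\<dots> = (\<integral>\<^sup>+ z. neg_power p (nrm (y + e *\<^sub>R z)) * indicator {z. norm (y + e *\<^sub>R z) < r} z \<partial>std_gaussian)
    + (\<integral>\<^sup>+ z. neg_power p (nrm (y + e *\<^sub>R z)) * indicator {z. r \<le> norm (y + e *\<^sub>R z)} z \<partial>std_gaussian)"
    by (rule nn_integral_add) measurable
  finally show ?thesis .
qed

lemma gauss_mean_far_integral_le:
  assumes r: "0 < r"
  shows "(\<integral>\<^sup>+ z. neg_power p (nrm (y + e *\<^sub>R z)) * indicator {z. r \<le> norm (y + e *\<^sub>R z)} z \<partial>std_gaussian)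
    \<le> ennreal ((m * r) powr - p)"
proof -
  interpret prob_space "std_gaussian :: (real ^ 'n) measure" by (rule prob_space_std_gaussian)
  have "(\<integral>\<^sup>+ z. neg_power p (nrm (y + e *\<^sub>R z)) * indicator {z. r \<le> norm (y + e *\<^sub>R z)} z \<partial>std_gaussian)
    \<le> (\<integral>\<^sup>+ z. ennreal ((m * r) powr - p) \<partial>(std_gaussian :: (real ^ 'n) measure))"
    by (intro nn_integral_mono) (auto simp: indicator_def intro: neg_power_nrm_far_le[OF r])
  then show ?thesis
    by (simp add: emeasure_space_1[simplified])
qed

lemma gauss_density_le_1: "gauss_density z \<le> 1" for z :: "real ^ 'n"
  unfolding gauss_density_eq using pi_gt3
  by (intro mult_le_one power_le_one) (auto simp: divide_simps intro: order_trans[of 1 2])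

lemma gauss_mean_finite:
  assumes e: "0 < e"
  shows "gauss_mean p nrm e y < \<infinity>"
proof -
  have "(\<integral>\<^sup>+ x. neg_power p (norm x) * indicator (ball 0 1) x \<partial>(lborel :: (real ^ 'n) measure)) < \<infinity>"
    using p by (intro nn_integral_neg_power_norm_unit_ball) auto
  then have "(\<integral>\<^sup>+ z. neg_power p (nrm (y + e *\<^sub>R z)) * indicator {z. norm (y + e *\<^sub>R z) < 1} z \<partial>std_gaussian) < \<infinity>"
    using gauss_density_le_1
    by (intro le_less_trans[OF gauss_mean_near_le[OF e, of 1 y 1]]) (auto simp: ennreal_mult_less_top)
  moreover have "(\<integral>\<^sup>+ z. neg_power p (nrm (y + e *\<^sub>R z)) * indicator {z. 1 \<le> norm (y + e *\<^sub>R z)} z \<partial>std_gaussian) < \<infinity>"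
    by (rule le_less_trans[OF gauss_mean_far_integral_le]) auto
  ultimately show ?thesis
    by (subst gauss_mean_split[of _ _ 1]) simp
qed

text \<open>If \<open>y + e *\<^sub>R z\<close> is shorter than \<open>norm y / 2\<close>, then
  \<open>norm z\<close> is at least \<open>\<rho> / 2\<close> with
  \<open>\<rho> = norm y / e\<close>, so the density is at most
  \<open>exp (- \<rho>\<^sup>2 / 8)\<close>. The bound without \<open>1 + norm y / e\<close> serves
  domination; the extra factor makes this part vanish as \<open>e\<close> tends to 0.\<close>

lemma gauss_mean_near_decay:
  obtains D where "0 \<le> D"
    "\<And>e y. 0 < e \<Longrightarrow> y \<noteq> 0 \<Longrightarrow>
      (\<integral>\<^sup>+ z. neg_power p (nrm (y + e *\<^sub>R z)) * indicator {z. norm (y + e *\<^sub>R z) < norm y / 2} z \<partial>std_gaussian)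
      \<le> ennreal (D / (1 + norm y / e) * norm y powr - p)"
proof -
  define A where "A = (\<integral>\<^sup>+ x. neg_power p (norm x) * indicator (ball 0 1) x \<partial>(lborel :: (real ^ 'n) measure))"
  have "A < \<infinity>"
    unfolding A_def using p by (intro nn_integral_neg_power_norm_unit_ball) auto
  then obtain a where a: "A = ennreal a" "0 \<le> a"
    by (cases A) auto
  have eighth: "0 < (1 / 8 :: real)"
    by simp
  \<comment> \<open>The power \<open>CARD('n)\<close> compensates the Jacobian; the additional one
    yields the factor \<open>1 / (1 + \<rho>)\<close>.\<close>
  obtain B :: real where B: "0 < B" "\<And>r. 0 \<le> r \<Longrightarrow> (1 + r) ^ (CARD('n) + 1) * exp (- (1 / 8) * r\<^sup>2) \<le> B"
    by (rule polynomial_mult_exp_neg_square_bounded[OF eighth, of "CARD('n) + 1"]) blast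
  show thesis
  proof (rule that)
    show "0 \<le> m powr - p * a * B"
      using a B by simp
    fix e :: real and y :: "real ^ 'n"
    assume e: "0 < e" and y: "y \<noteq> 0"
    define \<rho> where "\<rho> = norm y / e"
    have \<rho>: "0 < \<rho>" using e y by (simp add: \<rho>_def)
    define G where "G = exp (- (1 / 8) * \<rho>\<^sup>2)"
    have G: "gauss_density z \<le> G" if "norm (y + e *\<^sub>R z) < norm y / 2" for z
    proof -
      have "norm y \<le> norm (y + e *\<^sub>R z) + norm (e *\<^sub>R z)"
        using norm_triangle_ineq4[of "y + e *\<^sub>R z" "e *\<^sub>R z"] by simp
      then have "\<rho> / 2 \<le> norm z"
        using that e by (simp add: \<rho>_def field_simps)
      then have "(\<rho> / 2)\<^sup>2 \<le> (norm z)\<^sup>2"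
        using \<rho> by (intro power_mono) auto
      then have "exp (- (norm z)\<^sup>2 / 2) \<le> G"
        by (simp add: G_def power_divide)
      moreover have "(1 / sqrt (2 * pi)) ^ DIM(real ^ 'n) \<le> 1"
        using pi_gt3 by (intro power_le_one) (auto simp: divide_simps intro: order_trans[of 1 2])
      ultimately show ?thesis
        unfolding gauss_density_eq
        using mult_mono[of "(1 / sqrt (2 * pi)) ^ DIM(real ^ 'n)" 1 "exp (- (norm z)\<^sup>2 / 2)" G] by simp
    qed
    \<comment> \<open>With \<open>n = CARD('n)\<close>, \<open>norm y powr (n - p) / e ^ n\<close>
      equals \<open>\<rho> ^ n * norm y powr - p\<close>, and \<open>G\<close> absorbs
      \<open>\<rho> ^ n\<close>.\<close>
    have "G * m powr - p * (norm y / 2) powr (real CARD('n) - p) / e ^ CARD('n) * a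
      \<le> m powr - p * a * B / (1 + \<rho>) * norm y powr - p"
    proof -
      have "(norm y / 2) powr (real CARD('n) - p) \<le> norm y powr (real CARD('n) - p)"
        using p y by (intro powr_mono2) auto
      also have "\<dots> = norm y ^ CARD('n) * norm y powr - p"
        using y by (simp add: powr_diff powr_minus powr_realpow divide_inverse)
      finally have "(norm y / 2) powr (real CARD('n) - p) / e ^ CARD('n) \<le> \<rho> ^ CARD('n) * norm y powr - p"
        using e by (simp add: \<rho>_def power_divide divide_right_mono)
      then have "G * ((norm y / 2) powr (real CARD('n) - p) / e ^ CARD('n)) \<le> G * (\<rho> ^ CARD('n) * norm y powr - p)"
        by (rule mult_left_mono) (simp add: G_def)
      also have "\<dots> = \<rho> ^ CARD('n) * G * norm y powr - p"
        by simp
      also have "\<dots> \<le> B / (1 + \<rho>) * norm y powr - p"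
      proof (rule mult_right_mono)
        have "\<rho> ^ CARD('n) * G * (1 + \<rho>) \<le> (1 + \<rho>) ^ CARD('n) * G * (1 + \<rho>)"
          using \<rho> by (intro mult_right_mono power_mono) (auto simp: G_def)
        also have "\<dots> \<le> B"
          using B(2)[of \<rho>] \<rho> by (simp add: G_def mult_ac)
        finally show "\<rho> ^ CARD('n) * G \<le> B / (1 + \<rho>)"
          using \<rho> by (simp add: pos_le_divide_eq)
      qed simp
      finally have "m powr - p * a * (G * ((norm y / 2) powr (real CARD('n) - p) / e ^ CARD('n)))
        \<le> m powr - p * a * (B / (1 + \<rho>) * norm y powr - p)"
        using a by (intro mult_left_mono) auto
      then show ?thesis
        by (simp add: mult_ac)
    qed
    then have "ennreal (G * m powr - p * (norm y / 2) powr (real CARD('n) - p) / e ^ CARD('n)) * A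
      \<le> ennreal (m powr - p * a * B / (1 + \<rho>) * norm y powr - p)"
      unfolding a(1) using a e by (subst ennreal_mult[symmetric]) (auto simp: G_def intro!: ennreal_leI)
    then show "(\<integral>\<^sup>+ z. neg_power p (nrm (y + e *\<^sub>R z)) * indicator {z. norm (y + e *\<^sub>R z) < norm y / 2} z \<partial>std_gaussian)
      \<le> ennreal (m powr - p * a * B / (1 + norm y / e) * norm y powr - p)"
      using gauss_mean_near_le[OF e, of "norm y / 2" y G] G y unfolding A_def \<rho>_def by (auto intro: order_trans)
  qed
qed

text \<open>Near and far parts are both of order \<open>norm y powr - p\<close>, uniformly in
  \<open>e\<close>. This provides the integrable majorant for \<open>X\<close>; at
  \<open>y = 0\<close> the right side is infinite.\<close>

lemma gauss_mean_bound:
  obtains C where "0 < C" "\<And>e y. 0 < e \<Longrightarrow> gauss_mean p nrm e y \<le> ennreal C * neg_power p (nrm y)"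
proof -
  obtain D where D: "0 \<le> D" "\<And>e y. 0 < e \<Longrightarrow> y \<noteq> 0 \<Longrightarrow>
      (\<integral>\<^sup>+ z. neg_power p (nrm (y + e *\<^sub>R z)) * indicator {z. norm (y + e *\<^sub>R z) < norm y / 2} z \<partial>std_gaussian)
      \<le> ennreal (D / (1 + norm y / e) * norm y powr - p)"
    using gauss_mean_near_decay by blast
  \<comment> \<open>\<open>D\<close> bounds the near part, \<open>(m / 2) powr - p\<close> the part
    at distance at least \<open>norm y / 2\<close> from the origin, and \<open>L powr p\<close>
    converts \<open>norm y\<close> into \<open>nrm y\<close>.\<close>
  define C where "C = (D + (m / 2) powr - p) * L powr p"
  show thesis
  proof (rule that)
    show C: "0 < C"
      using D mL by (auto simp: C_def intro!: mult_pos_pos add_nonneg_pos)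
    fix e :: real and y :: "real ^ 'n"
    assume e: "0 < e"
    show "gauss_mean p nrm e y \<le> ennreal C * neg_power p (nrm y)"
    proof (cases "y = 0")
      case True
      then have "nrm y = 0"
        using nrm_nonneg[of y] mL(4)[of y] by simp
      then show ?thesis
        using C by (simp add: neg_power_def ennreal_mult_top)
    next
      case False
      have "D / (1 + norm y / e) * norm y powr - p \<le> D * norm y powr - p"
        using D(1) e divide_left_mono[of 1 "1 + norm y / e" D] by (intro mult_right_mono) (auto simp: add_pos_nonneg)
      then have "gauss_mean p nrm e y \<le> ennreal (D * norm y powr - p) + ennreal ((m * (norm y / 2)) powr - p)"
        unfolding gauss_mean_split[of e y "norm y / 2"]
        using False by (intro add_mono gauss_mean_far_integral_le order_trans[OF D(2)[OF e]] ennreal_leI) auto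
      also have "\<dots> = ennreal ((D + (m / 2) powr - p) * norm y powr - p)"
        using D(1) mL powr_mult[of "m / 2" "norm y" "- p"]
        by (subst ennreal_plus[symmetric]) (simp_all add: algebra_simps)
      also have "\<dots> \<le> ennreal (C * nrm y powr - p)"
      proof (rule ennreal_leI)
        have "0 < nrm y"
          using False hom by (simp add: homogeneous_space_def)
        then have "(L * norm y) powr - p \<le> nrm y powr - p"
          using mL p by (intro powr_mono2') auto
        then have "L powr p * (L powr - p * norm y powr - p) \<le> L powr p * nrm y powr - p"
          using mL by (intro mult_left_mono) (auto simp: powr_mult)
        then have "norm y powr - p \<le> L powr p * nrm y powr - p"
          using mL by (simp add: powr_minus field_simps)
        then show "(D + (m / 2) powr - p) * norm y powr - p \<le> C * nrm y powr - p"
          unfolding C_def mult.assoc using D by (intro mult_left_mono) auto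
      qed
      also have "\<dots> = ennreal C * neg_power p (nrm y)"
        using C False hom by (auto simp: neg_power_def ennreal_mult homogeneous_space_def)
      finally show ?thesis .
    qed
  qed
qed

lemma tendsto_neg_power_nrm_shift:
  assumes "e \<longlonglongrightarrow> 0"
  shows "(\<lambda>k. neg_power p (nrm (y + e k *\<^sub>R z))) \<longlonglongrightarrow> neg_power p (nrm y)"
proof (intro tendsto_neg_power p nrm_nonneg)
  have "(\<lambda>k. y + e k *\<^sub>R z) \<longlonglongrightarrow> y + 0 *\<^sub>R z"
    by (intro tendsto_intros assms)
  moreover have "isCont nrm y"
    using nrm_continuous by (simp add: continuous_on_eq_continuous_at)
  ultimately show "(\<lambda>k. nrm (y + e k *\<^sub>R z)) \<longlonglongrightarrow> nrm y"
    by (intro isCont_tendsto_compose[where g = nrm]) auto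
qed

text \<open>Fatou's lemma under the Gaussian; this covers \<open>y = 0\<close>, where the left side
  is infinite.\<close>

lemma neg_power_nrm_le_liminf_gauss_mean:
  assumes "e \<longlonglongrightarrow> 0"
  shows "neg_power p (nrm y) \<le> liminf (\<lambda>k. gauss_mean p nrm (e k) y)"
proof -
  interpret prob_space "std_gaussian :: (real ^ 'n) measure" by (rule prob_space_std_gaussian)
  have "neg_power p (nrm y) = (\<integral>\<^sup>+ z. liminf (\<lambda>k. neg_power p (nrm (y + e k *\<^sub>R z))) \<partial>std_gaussian)"
    by (simp add: lim_imp_Liminf[OF _ tendsto_neg_power_nrm_shift[OF assms]] emeasure_space_1[simplified])
  also have "\<dots> \<le> liminf (\<lambda>k. gauss_mean p nrm (e k) y)"
    unfolding gauss_mean_def by (rule nn_integral_liminf) measurable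
  finally show ?thesis .
qed

text \<open>Cut at distance \<open>norm y / 2\<close> from the singularity: the near part tends to 0
  by \<open>gauss_mean_near_decay\<close>, while the far part has a bounded integrand and converges
  by dominated convergence.\<close>

lemma gauss_mean_tendsto:
  assumes e: "e \<longlonglongrightarrow> 0" "\<And>k. 0 < e k" and y: "y \<noteq> 0"
  shows "(\<lambda>k. gauss_mean p nrm (e k) y) \<longlonglongrightarrow> neg_power p (nrm y)"
proof -
  interpret prob_space "std_gaussian :: (real ^ 'n) measure" by (rule prob_space_std_gaussian)
  let ?N = "\<lambda>k. \<integral>\<^sup>+ z. neg_power p (nrm (y + e k *\<^sub>R z)) * indicator {z. norm (y + e k *\<^sub>R z) < norm y / 2} z \<partial>std_gaussian"
  let ?F = "\<lambda>k. \<integral>\<^sup>+ z. neg_power p (nrm (y + e k *\<^sub>R z)) * indicator {z. norm y / 2 \<le> norm (y + e k *\<^sub>R z)} z \<partial>std_gaussian"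
  obtain D where D: "0 \<le> D" "\<And>e y. 0 < e \<Longrightarrow> y \<noteq> 0 \<Longrightarrow>
      (\<integral>\<^sup>+ z. neg_power p (nrm (y + e *\<^sub>R z)) * indicator {z. norm (y + e *\<^sub>R z) < norm y / 2} z \<partial>std_gaussian)
      \<le> ennreal (D / (1 + norm y / e) * norm y powr - p)"
    using gauss_mean_near_decay by blast
  have "?N \<longlonglongrightarrow> 0"
  proof (rule tendsto_sandwich[OF _ _ tendsto_const])
    show "\<forall>\<^sub>F k in sequentially. ?N k \<le> ennreal (D * norm y powr - p / norm y * e k)"
    proof (intro always_eventually allI order_trans[OF D(2)[OF e(2) y]] ennreal_leI)
      fix k
      \<comment> \<open>Omitting the summand 1 in the denominator makes the bound linear in
        \<open>e k\<close>.\<close>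
      have "D / (1 + norm y / e k) \<le> D / (norm y / e k)"
        using D(1) e(2)[of k] y by (intro divide_left_mono mult_pos_pos add_pos_pos) auto
      then have "D / (1 + norm y / e k) * norm y powr - p \<le> D / (norm y / e k) * norm y powr - p"
        by (rule mult_right_mono) simp
      then show "D / (1 + norm y / e k) * norm y powr - p \<le> D * norm y powr - p / norm y * e k"
        by (simp add: mult_ac)
    qed
    have "(\<lambda>k. ennreal (D * norm y powr - p / norm y * e k)) \<longlonglongrightarrow> ennreal (D * norm y powr - p / norm y * 0)"
      by (intro tendsto_intros e)
    then show "(\<lambda>k. ennreal (D * norm y powr - p / norm y * e k)) \<longlonglongrightarrow> 0"
      by simp
  qed simp
  moreover have "?F \<longlonglongrightarrow> (\<integral>\<^sup>+ z. neg_power p (nrm y) \<partial>(std_gaussian :: (real ^ 'n) measure))"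
  proof (rule nn_integral_dominated_convergence[where w = "\<lambda>_. ennreal ((m * (norm y / 2)) powr - p)"])
    show "AE z in std_gaussian. neg_power p (nrm (y + e k *\<^sub>R z)) * indicator {z. norm y / 2 \<le> norm (y + e k *\<^sub>R z)} z
        \<le> ennreal ((m * (norm y / 2)) powr - p)" for k
      using y neg_power_nrm_far_le[of "norm y / 2"] by (auto simp: indicator_def split: split_of_bool)
    show "(\<integral>\<^sup>+ z. ennreal ((m * (norm y / 2)) powr - p) \<partial>(std_gaussian :: (real ^ 'n) measure)) < \<infinity>"
      by (simp add: emeasure_space_1[simplified])
    show "AE z in std_gaussian. (\<lambda>k. neg_power p (nrm (y + e k *\<^sub>R z)) * indicator {z. norm y / 2 \<le> norm (y + e k *\<^sub>R z)} z)
        \<longlonglongrightarrow> neg_power p (nrm y)"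
    proof (rule AE_I2)
      fix z
      \<comment> \<open>The shifted point tends to \<open>y\<close>, so its norm eventually exceeds
        \<open>norm y / 2\<close> and the indicator equals 1.\<close>
      have "(\<lambda>k. norm (y + e k *\<^sub>R z)) \<longlonglongrightarrow> norm (y + 0 *\<^sub>R z)"
        by (intro tendsto_intros e)
      then have "\<forall>\<^sub>F k in sequentially. norm y / 2 < norm (y + e k *\<^sub>R z)"
        using y by (intro order_tendstoD(1)) auto
      then have "\<forall>\<^sub>F k in sequentially. neg_power p (nrm (y + e k *\<^sub>R z))
        = neg_power p (nrm (y + e k *\<^sub>R z)) * indicator {z. norm y / 2 \<le> norm (y + e k *\<^sub>R z)} z"
        by eventually_elim auto
      then show "(\<lambda>k. neg_power p (nrm (y + e k *\<^sub>R z)) * indicator {z. norm y / 2 \<le> norm (y + e k *\<^sub>R z)} z)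
        \<longlonglongrightarrow> neg_power p (nrm y)"
        by (rule Lim_transform_eventually[OF tendsto_neg_power_nrm_shift[OF e(1)]])
    qed
  qed measurable
  ultimately have "(\<lambda>k. ?N k + ?F k) \<longlonglongrightarrow> 0 + (\<integral>\<^sup>+ z. neg_power p (nrm y) \<partial>(std_gaussian :: (real ^ 'n) measure))"
    by (rule tendsto_add)
  then show ?thesis
    by (simp add: gauss_mean_split[of _ y "norm y / 2"] emeasure_space_1[simplified])
qed

end

section \<open>The embedding identity for smoothed kernels\<close>

text \<open>The radial weight of the embedding identity together with the damping factor of the
  Gaussian's Fourier transform along a unit vector. The damping makes the measure finite, so bounded
  integrands can be exchanged freely.\<close>

definition gamma_measure :: "real \<Rightarrow> real \<Rightarrow> real measure" where
  "gamma_measure p e = density lborel (\<lambda>t. ennreal (\<bar>t\<bar> powr (p - 1) * exp (- (e * \<bar>t\<bar>)\<^sup>2 / 2)))"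

lemma sets_gamma_measure[measurable_cong, simp]: "sets (gamma_measure p e) = sets borel"
  by (simp add: gamma_measure_def)

text \<open>Near 0 the density is integrable because \<open>p - 1 > - 1\<close>. For
  \<open>\<bar>t\<bar> > 1\<close>, half of the Gaussian exponent absorbs the power of
  \<open>t\<close>; the other half is a multiple of a normal density.\<close>

lemma finite_gamma_measure:
  assumes p: "0 < p" and e: "0 < e"
  shows "finite_measure (gamma_measure p e)"
proof
  let ?h = "\<lambda>t::real. \<bar>t\<bar> powr (p - 1) * exp (- (e * \<bar>t\<bar>)\<^sup>2 / 2)"
  define k where "k = nat \<lceil>p\<rceil>"
  obtain B where B: "0 < B" "\<And>r. 0 \<le> r \<Longrightarrow> (1 + r) ^ k * exp (- (e\<^sup>2 / 4) * r\<^sup>2) \<le> B"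
    using polynomial_mult_exp_neg_square_bounded[of "e\<^sup>2 / 4" k] e by auto
  \<comment> \<open>Solves \<open>1 / (2 * \<sigma>\<^sup>2) = e\<^sup>2 / 4\<close>, matching the
    remaining half of the exponent.\<close>
  define \<sigma> where "\<sigma> = sqrt 2 / e"
  have \<sigma>: "0 < \<sigma>" "\<sigma>\<^sup>2 = 2 / e\<^sup>2"
    using e by (simp_all add: \<sigma>_def power_divide)
  have normal: "exp (- (e\<^sup>2 / 4) * t\<^sup>2) = sqrt (2 * pi * \<sigma>\<^sup>2) * normal_density 0 \<sigma> t" for t
    using \<sigma> e by (simp add: normal_density_def)
  have bound: "?h t \<le> \<bar>t\<bar> powr (p - 1) * indicator {-1..1} t + B * sqrt (2 * pi * \<sigma>\<^sup>2) * normal_density 0 \<sigma> t" for t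
  proof (cases "\<bar>t\<bar> \<le> 1")
    case True
    then have "?h t \<le> \<bar>t\<bar> powr (p - 1) * indicator {-1..1} t"
      using mult_left_le[of "exp (- (e * \<bar>t\<bar>)\<^sup>2 / 2)" "\<bar>t\<bar> powr (p - 1)"] by (simp add: indicator_def abs_le_iff)
    then show ?thesis
      using B by (simp add: add_increasing2)
  next
    case False
    then have "\<bar>t\<bar> powr (p - 1) \<le> \<bar>t\<bar> powr real k"
      using p le_of_int_ceiling[of p] by (intro powr_mono) (auto simp: k_def simp del: le_of_int_ceiling)
    also have "\<dots> = \<bar>t\<bar> ^ k"
      using False by (subst powr_realpow) auto
    also have "\<dots> \<le> (1 + \<bar>t\<bar>) ^ k"
      by (intro power_mono) auto
    finally have 1: "?h t \<le> (1 + \<bar>t\<bar>) ^ k * exp (- (e * \<bar>t\<bar>)\<^sup>2 / 2)"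
      by (rule mult_right_mono) simp
    have 2: "exp (- (e * \<bar>t\<bar>)\<^sup>2 / 2) = exp (- (e\<^sup>2 / 4) * t\<^sup>2) * exp (- (e\<^sup>2 / 4) * t\<^sup>2)"
      by (simp add: power_mult_distrib field_simps flip: exp_add)
    have 3: "(1 + \<bar>t\<bar>) ^ k * (exp (- (e\<^sup>2 / 4) * t\<^sup>2) * exp (- (e\<^sup>2 / 4) * t\<^sup>2)) \<le> B * exp (- (e\<^sup>2 / 4) * t\<^sup>2)"
      using B(2)[of "\<bar>t\<bar>"] unfolding mult.assoc[symmetric] by (intro mult_right_mono) auto
    have 4: "B * exp (- (e\<^sup>2 / 4) * t\<^sup>2) = B * sqrt (2 * pi * \<sigma>\<^sup>2) * normal_density 0 \<sigma> t"
      unfolding normal by simp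
    have "?h t \<le> B * sqrt (2 * pi * \<sigma>\<^sup>2) * normal_density 0 \<sigma> t"
      using 1 3 unfolding 2 4 by (rule order_trans)
    then show ?thesis
      by (rule add_increasing[rotated]) simp
  qed
  have "(\<integral>\<^sup>+ t. ennreal (?h t) \<partial>lborel) \<le> (\<integral>\<^sup>+ t. ennreal (\<bar>t\<bar> powr (p - 1) * indicator {-1..1} t)
    + ennreal (B * sqrt (2 * pi * \<sigma>\<^sup>2) * normal_density 0 \<sigma> t) \<partial>lborel)"
  proof (rule nn_integral_mono)
    fix t
    show "ennreal (?h t) \<le> ennreal (\<bar>t\<bar> powr (p - 1) * indicator {-1..1} t)
      + ennreal (B * sqrt (2 * pi * \<sigma>\<^sup>2) * normal_density 0 \<sigma> t)"
      using ennreal_leI[OF bound[of t]] B by (subst ennreal_plus[symmetric]) auto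
  qed
  also have "\<dots> = (\<integral>\<^sup>+ t. ennreal (\<bar>t\<bar> powr (p - 1) * indicator {-1..1} t) \<partial>lborel)
    + (\<integral>\<^sup>+ t. ennreal (B * sqrt (2 * pi * \<sigma>\<^sup>2) * normal_density 0 \<sigma> t) \<partial>lborel)"
    by (rule nn_integral_add) measurable
  also have "\<dots> < \<infinity>"
    using nn_integral_abs_powr[of "p - 1"] p B \<sigma>(1)
    by (subst nn_integral_eq_integral[of _ "\<lambda>t. B * sqrt (2 * pi * \<sigma>\<^sup>2) * normal_density 0 \<sigma> t"])
      (auto simp: integrable_normal_density)
  finally show "emeasure (gamma_measure p e) (space (gamma_measure p e)) \<noteq> \<infinity>"
    by (simp add: gamma_measure_def emeasure_density)
qed

lemma (in finite_measure) Fubini_bounded: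
  fixes f :: "'a \<Rightarrow> 'b \<Rightarrow> real"
  assumes N: "finite_measure N" and f: "case_prod f \<in> borel_measurable (M \<Otimes>\<^sub>M N)"
    and bound: "\<And>x y. x \<in> space M \<Longrightarrow> y \<in> space N \<Longrightarrow> \<bar>f x y\<bar> \<le> B"
  shows "(LINT x|M. LINT y|N. f x y) = (LINT y|N. LINT x|M. f x y)"
proof -
  interpret N: finite_measure N by fact
  interpret pair_sigma_finite M N ..
  have "finite_measure (M \<Otimes>\<^sub>M N)"
    by (rule finite_measure_pair_measure) unfold_locales
  then have "integrable (M \<Otimes>\<^sub>M N) (case_prod f)"
    using f bound by (intro finite_measure.integrable_const_bound[where B = B]) (auto simp: space_pair_measure)
  then show ?thesis
    by (rule Fubini_integral[symmetric])
qed

section \<open>The real-valued smoothed kernel as an integral of cosines\<close>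

definition smoothed_kernel :: "real \<Rightarrow> (real ^ 'n::finite \<Rightarrow> real) \<Rightarrow> real \<Rightarrow> real ^ 'n \<Rightarrow> real" where
  "smoothed_kernel p nrm e y = (LINT z|std_gaussian. nrm (y + e *\<^sub>R z) powr - p)"

lemma smoothed_kernel_nonneg: "0 \<le> smoothed_kernel p nrm e y"
  unfolding smoothed_kernel_def by (rule integral_nonneg_AE) simp

lemma AE_std_gaussian_shift_nonzero:
  assumes "0 < e"
  shows "AE z in std_gaussian. y + e *\<^sub>R z \<noteq> 0"
proof -
  have "y + e *\<^sub>R z \<noteq> 0" if "z \<noteq> - y /\<^sub>R e" for z
    using that assms by (auto simp: add_eq_0_iff2)
  then show ?thesis
    unfolding AE_std_gaussian using AE_lborel_singleton[of "- y /\<^sub>R e"] by (auto elim: eventually_mono)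
qed

lemma gauss_mean_eq_smoothed_kernel:
  fixes nrm :: "real ^ 'n::finite \<Rightarrow> real"
  assumes p: "0 < p" "p < real CARD('n)" and hom: "homogeneous_space nrm" and e: "0 < e"
  shows "gauss_mean p nrm e y = ennreal (smoothed_kernel p nrm e y)"
proof -
  obtain m L where mL: "0 < m" "0 < L" "\<And>x. m * norm x \<le> nrm x" "\<And>x. nrm x \<le> L * norm x"
    using homogeneous_space_bounds[OF hom] by blast
  note [measurable] = nrm_measurable[OF p hom mL]
  have eq: "gauss_mean p nrm e y = (\<integral>\<^sup>+ z. ennreal (nrm (y + e *\<^sub>R z) powr - p) \<partial>std_gaussian)"
    unfolding gauss_mean_def using AE_std_gaussian_shift_nonzero[OF e, of y]
  proof (intro nn_integral_cong_AE, eventually_elim)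
    case (elim z)
    then have "0 < nrm (y + e *\<^sub>R z)"
      using hom by (simp add: homogeneous_space_def)
    then show ?case
      by (simp add: neg_power_def)
  qed
  have "integrable std_gaussian (\<lambda>z. nrm (y + e *\<^sub>R z) powr - p)"
    using gauss_mean_finite[OF p hom mL e, of y] unfolding eq by (intro integrableI_nonneg) auto
  then show ?thesis
    unfolding eq smoothed_kernel_def by (rule nn_integral_eq_integral) simp
qed

lemma measurable_sphere_borel:
  assumes "sets \<gamma> = sets (restrict_space borel (sphere 0 1))"
  shows "(\<lambda>\<xi>. \<xi>) \<in> measurable \<gamma> borel"
  using measurable_restrict_space1[OF measurable_ident] assms by (simp add: id_def cong: measurable_cong_sets)

text \<open>The embedding identity tested against a Gaussian centred at \<open>y\<close>.\<close>

lemma smoothed_kernel_embedding: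
  fixes nrm :: "real ^ 'n::finite \<Rightarrow> real" and \<gamma> :: "(real ^ 'n) measure"
  assumes p: "0 < p" "p < real CARD('n)" and hom: "homogeneous_space nrm" and e: "0 < e"
    and sets: "sets \<gamma> = sets (restrict_space borel (sphere 0 1))" and fin: "finite_measure \<gamma>"
    and emb: "\<And>\<phi>. schwartz \<phi> \<Longrightarrow> (CLINT x | lborel. (nrm x powr (- p)) *\<^sub>R \<phi> x) =
           (CLINT \<xi> | \<gamma>. CLINT t | lborel. (\<bar>t\<bar> powr (p - 1)) *\<^sub>R fourier \<phi> (t *\<^sub>R \<xi>))"
  shows "smoothed_kernel p nrm e y = (LINT \<xi>|\<gamma>. LINT t|gamma_measure p e. cos ((t *\<^sub>R \<xi>) \<bullet> y))"
proof -
  interpret G: finite_measure \<gamma> by fact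
  interpret N: finite_measure "gamma_measure p e" by (rule finite_gamma_measure[OF p(1) e])
  obtain m L where mL: "0 < m" "0 < L" "\<And>x. m * norm x \<le> nrm x" "\<And>x. nrm x \<le> L * norm x"
    using homogeneous_space_bounds[OF hom] by blast
  note [measurable] = nrm_measurable[OF p hom mL] measurable_sphere_borel[OF sets]
  have space: "space \<gamma> = sphere 0 1"
    using sets_eq_imp_space_eq[OF sets] by (simp add: space_restrict_space)
  have "complex_of_real (smoothed_kernel p nrm e y) = (CLINT z|std_gaussian. complex_of_real (nrm (y + e *\<^sub>R z) powr - p))"
    by (simp add: smoothed_kernel_def)
  also have "\<dots> = (CLINT x|lborel. complex_of_real (nrm x powr - p) * gauss_kernel e y x)"
    by (rule integral_gauss_kernel[OF _ e, symmetric]) measurable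
  also have "\<dots> = (CLINT \<xi> | \<gamma>. CLINT t | lborel. (\<bar>t\<bar> powr (p - 1)) *\<^sub>R fourier (gauss_kernel e y) (t *\<^sub>R \<xi>))"
    using emb[OF schwartz_gauss_kernel[OF e, of y]] by (simp add: scaleR_conv_of_real)
  also have "\<dots> = (CLINT \<xi> | \<gamma>. CLINT t | gamma_measure p e. iexp (- (y \<bullet> (t *\<^sub>R \<xi>))))"
  proof (rule Bochner_Integration.integral_cong[OF refl])
    fix \<xi> assume "\<xi> \<in> space \<gamma>"
    then have \<xi>: "norm \<xi> = 1"
      by (simp add: space)
    have "(CLINT t | gamma_measure p e. iexp (- (y \<bullet> (t *\<^sub>R \<xi>))))
      = (CLINT t | lborel. (\<bar>t\<bar> powr (p - 1) * exp (- (e * \<bar>t\<bar>)\<^sup>2 / 2)) *\<^sub>R iexp (- (y \<bullet> (t *\<^sub>R \<xi>))))"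
      unfolding gamma_measure_def by (rule integral_density) auto
    also have "\<dots> = (CLINT t | lborel. (\<bar>t\<bar> powr (p - 1)) *\<^sub>R fourier (gauss_kernel e y) (t *\<^sub>R \<xi>))"
      unfolding fourier_gauss_kernel[OF e] norm_scaleR \<xi>
      by (intro Bochner_Integration.integral_cong) (simp_all add: scaleR_conv_of_real mult_ac)
    finally show "(CLINT t | lborel. (\<bar>t\<bar> powr (p - 1)) *\<^sub>R fourier (gauss_kernel e y) (t *\<^sub>R \<xi>))
      = (CLINT t | gamma_measure p e. iexp (- (y \<bullet> (t *\<^sub>R \<xi>))))" ..
  qed
  finally have "complex_of_real (smoothed_kernel p nrm e y)
    = (CLINT \<xi> | \<gamma>. CLINT t | gamma_measure p e. iexp (- (y \<bullet> (t *\<^sub>R \<xi>))))" .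
  \<comment> \<open>The left side is real, so the exponential may be replaced by its cosine
    part.\<close>
  then have "smoothed_kernel p nrm e y = Re (CLINT \<xi> | \<gamma>. CLINT t | gamma_measure p e. iexp (- (y \<bullet> (t *\<^sub>R \<xi>))))"
    by (metis Re_complex_of_real)
  also have "\<dots> = (LINT \<xi> | \<gamma>. Re (CLINT t | gamma_measure p e. iexp (- (y \<bullet> (t *\<^sub>R \<xi>)))))"
  proof (rule integral_Re[symmetric, OF G.integrable_const_bound])
    show "AE \<xi> in \<gamma>. cmod (CLINT t | gamma_measure p e. iexp (- (y \<bullet> (t *\<^sub>R \<xi>)))) \<le> (LINT t|gamma_measure p e. 1)"
      by (intro AE_I2 order_trans[OF integral_norm_bound]) simp
  qed measurable
  also have "\<dots> = (LINT \<xi>|\<gamma>. LINT t|gamma_measure p e. Re (iexp (- (y \<bullet> (t *\<^sub>R \<xi>)))))"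
    by (intro Bochner_Integration.integral_cong refl integral_Re[symmetric]
        N.integrable_const_bound[of _ 1]) auto
  finally show ?thesis
    by (simp add: Re_exp inner_commute)
qed

text \<open>Cosines are bounded and the three measures are finite, so the expectation moves inside
  by Fubini, first past \<open>\<gamma>\<close> and then past \<open>gamma_measure p e\<close>. The
  integrability claims feed the later monotonicity argument.\<close>

lemma expectation_smoothed_kernel:
  fixes nrm :: "real ^ 'n::finite \<Rightarrow> real" and \<gamma> :: "(real ^ 'n) measure"
  assumes p: "0 < p" and e: "0 < e"
    and sets: "sets \<gamma> = sets (restrict_space borel (sphere 0 1))" and fin: "finite_measure \<gamma>"
    and repr: "\<And>y. smoothed_kernel p nrm e y = (LINT \<xi>|\<gamma>. LINT t|gamma_measure p e. cos ((t *\<^sub>R \<xi>) \<bullet> y))"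
    and M: "prob_space M" and X[measurable]: "X \<in> borel_measurable M"
  shows "integrable M (\<lambda>\<omega>. smoothed_kernel p nrm e (X \<omega>))"
    and "(LINT \<omega>|M. smoothed_kernel p nrm e (X \<omega>))
      = (LINT \<xi>|\<gamma>. LINT t|gamma_measure p e. Re (char_functional M X (t *\<^sub>R \<xi>)))"
    and "integrable \<gamma> (\<lambda>\<xi>. LINT t|gamma_measure p e. Re (char_functional M X (t *\<^sub>R \<xi>)))"
    and "integrable (gamma_measure p e) (\<lambda>t. Re (char_functional M X (t *\<^sub>R \<xi>)))"
proof -
  interpret M: prob_space M by fact
  interpret G: finite_measure \<gamma> by fact
  interpret N: finite_measure "gamma_measure p e" by (rule finite_gamma_measure[OF p e])
  have Re_char: "Re (char_functional M X \<eta>) = (LINT \<omega>|M. cos (\<eta> \<bullet> X \<omega>))" for \<eta>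
  proof -
    have "Re (char_functional M X \<eta>) = (LINT \<omega>|M. Re (iexp (\<eta> \<bullet> X \<omega>)))"
      unfolding char_functional_def
      by (intro integral_Re[symmetric] M.integrable_const_bound[of _ 1]) auto
    then show ?thesis
      by (simp add: Re_exp)
  qed
  have bound1: "\<bar>LINT t|gamma_measure p e. cos ((t *\<^sub>R \<xi>) \<bullet> y)\<bar> \<le> (LINT t|gamma_measure p e. 1)" for \<xi> y :: "real ^ 'n"
    by (intro order_trans[OF integral_abs_bound] integral_mono N.integrable_const_bound[of _ 1]) auto
  have bound2: "\<bar>LINT \<omega>|M. cos (\<eta> \<bullet> X \<omega>)\<bar> \<le> 1" for \<eta>
  proof -
    have "\<bar>LINT \<omega>|M. cos (\<eta> \<bullet> X \<omega>)\<bar> \<le> (LINT \<omega>|M. 1)"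
      by (intro order_trans[OF integral_abs_bound] integral_mono M.integrable_const_bound[of _ 1]) auto
    then show ?thesis by (simp add: M.prob_space)
  qed
  have swap2: "(LINT \<omega>|M. LINT t|gamma_measure p e. cos ((t *\<^sub>R \<xi>) \<bullet> X \<omega>))
    = (LINT t|gamma_measure p e. LINT \<omega>|M. cos ((t *\<^sub>R \<xi>) \<bullet> X \<omega>))" for \<xi>
  proof (rule M.Fubini_bounded[OF N.finite_measure_axioms])
    show "(\<lambda>(\<omega>, t). cos ((t *\<^sub>R \<xi>) \<bullet> X \<omega>)) \<in> borel_measurable (M \<Otimes>\<^sub>M gamma_measure p e)"
      by measurable
  qed (rule abs_cos_le_one)
  show 1: "integrable (gamma_measure p e) (\<lambda>t. Re (char_functional M X (t *\<^sub>R \<xi>)))" for \<xi>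
    unfolding Re_char
  proof (rule N.integrable_const_bound)
    show "AE t in gamma_measure p e. norm (LINT \<omega>|M. cos ((t *\<^sub>R \<xi>) \<bullet> X \<omega>)) \<le> 1"
      unfolding real_norm_def by (intro AE_I2 bound2)
  qed measurable
  note [measurable] = measurable_sphere_borel[OF sets]
  show "integrable M (\<lambda>\<omega>. smoothed_kernel p nrm e (X \<omega>))"
    unfolding repr
  proof (rule M.integrable_const_bound)
    have "\<bar>LINT \<xi>|\<gamma>. LINT t|gamma_measure p e. cos ((t *\<^sub>R \<xi>) \<bullet> y)\<bar> \<le> (LINT \<xi>|\<gamma>. LINT t|gamma_measure p e. 1)" for y
    proof (rule order_trans[OF integral_abs_bound], rule integral_mono[OF _ G.integrable_const bound1], rule integrable_abs)
      show "integrable \<gamma> (\<lambda>\<xi>. LINT t|gamma_measure p e. cos ((t *\<^sub>R \<xi>) \<bullet> y))"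
        by (rule G.integrable_const_bound[OF AE_I2], unfold real_norm_def, rule bound1) measurable
    qed
    then show "AE \<omega> in M. norm (LINT \<xi>|\<gamma>. LINT t|gamma_measure p e. cos ((t *\<^sub>R \<xi>) \<bullet> X \<omega>))
      \<le> (LINT \<xi>|\<gamma>. LINT t|gamma_measure p e. 1)"
      by (intro AE_I2) (unfold real_norm_def)
  qed measurable
  have swap1: "(LINT \<omega>|M. LINT \<xi>|\<gamma>. LINT t|gamma_measure p e. cos ((t *\<^sub>R \<xi>) \<bullet> X \<omega>))
    = (LINT \<xi>|\<gamma>. LINT \<omega>|M. LINT t|gamma_measure p e. cos ((t *\<^sub>R \<xi>) \<bullet> X \<omega>))"
    by (rule M.Fubini_bounded[OF fin _ bound1]) measurable
  show "(LINT \<omega>|M. smoothed_kernel p nrm e (X \<omega>))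
      = (LINT \<xi>|\<gamma>. LINT t|gamma_measure p e. Re (char_functional M X (t *\<^sub>R \<xi>)))"
    unfolding repr Re_char swap1 swap2 ..
  show "integrable \<gamma> (\<lambda>\<xi>. LINT t|gamma_measure p e. Re (char_functional M X (t *\<^sub>R \<xi>)))"
    unfolding Re_char
  proof (rule G.integrable_const_bound)
    have "\<bar>LINT t|gamma_measure p e. LINT \<omega>|M. cos ((t *\<^sub>R \<xi>) \<bullet> X \<omega>)\<bar> \<le> (LINT t|gamma_measure p e. 1)" for \<xi>
      by (rule order_trans[OF integral_abs_bound
            integral_mono[OF integrable_abs[OF 1[unfolded Re_char]] N.integrable_const bound2]])
    then show "AE \<xi> in \<gamma>. norm (LINT t|gamma_measure p e. LINT \<omega>|M. cos ((t *\<^sub>R \<xi>) \<bullet> X \<omega>)) \<le> (LINT t|gamma_measure p e. 1)"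
      by simp
  qed measurable
qed

section \<open>Reflection of the second block\<close>

definition flip :: "real ^ ('k::finite + 'm::finite) \<Rightarrow> real ^ ('k + 'm)" where
  "flip x = join_coords (fst_coords x) (- snd_coords x)"

lemma flip_nth: "flip x $ l = (case l of Inl _ \<Rightarrow> 1 | Inr _ \<Rightarrow> - 1) * x $ l"
  by (simp add: flip_def join_coords_def fst_coords_def snd_coords_def split: sum.split)

lemma join_fst_snd: "join_coords (fst_coords x) (snd_coords x) = x"
  by (simp add: join_coords_def fst_coords_def snd_coords_def vec_eq_iff split: sum.split)

lemma flip_affine: "flip (x + c *\<^sub>R y) = flip x + c *\<^sub>R flip y"
  by (simp add: vec_eq_iff flip_nth algebra_simps)

lemma norm_flip: "norm (flip x) = norm x"
  unfolding norm_vec_def by (intro L2_set_cong) (auto simp: flip_nth split: sum.split)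

lemma inner_flip: "u \<bullet> flip x = flip u \<bullet> x"
  by (simp add: inner_vec_def flip_nth mult_ac)

lemma measurable_flip[measurable]: "flip \<in> borel_measurable borel"
proof (rule borel_measurable_continuous_onI)
  show "continuous_on UNIV (flip :: real ^ ('k::finite + 'm::finite) \<Rightarrow> _)"
    unfolding flip_def join_coords_def
  proof (rule continuous_on_vec_lambda)
    fix l :: "'k + 'm"
    show "continuous_on UNIV (\<lambda>x :: real ^ ('k + 'm). case l of Inl i \<Rightarrow> fst_coords x $ i | Inr j \<Rightarrow> (- snd_coords x) $ j)"
      by (cases l) (auto simp: fst_coords_def snd_coords_def intro!: continuous_intros)
  qed
qed

text \<open>In the standard basis the reflection is diagonal with entries 1 and -1, so its Jacobian
  is 1.\<close>

lemma lborel_distr_flip: "distr lborel borel flip = (lborel :: (real ^ ('k::finite + 'm::finite)) measure)"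
proof -
  \<comment> \<open>On a basis vector \<open>j\<close>, \<open>j \<bullet> flip j\<close> is the
    corresponding diagonal entry.\<close>
  define c :: "real ^ ('k + 'm) \<Rightarrow> real" where "c = (\<lambda>j. j \<bullet> flip j)"
  have c: "flip x \<bullet> j = c j * (x \<bullet> j)" "\<bar>c j\<bar> = 1" if "j \<in> Basis" for j x
  proof -
    obtain l where "j = axis l 1"
      using \<open>j \<in> Basis\<close> by (auto simp: Basis_vec_def)
    then show "flip x \<bullet> j = c j * (x \<bullet> j)" "\<bar>c j\<bar> = 1"
      by (simp_all add: c_def inner_axis inner_axis' flip_nth split: sum.split)
  qed
  have "(\<lambda>x. 0 + (\<Sum>j\<in>Basis. (c j * (x \<bullet> j)) *\<^sub>R j)) = flip"
    by (simp add: fun_eq_iff c(1)[symmetric] euclidean_representation)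
  moreover have "c j \<noteq> 0" if "j \<in> Basis" for j
    using c(2)[OF that] by auto
  ultimately have "lborel = density (distr lborel borel (flip :: real ^ ('k + 'm) \<Rightarrow> _)) (\<lambda>_. \<Prod>j\<in>Basis. \<bar>c j\<bar>)"
    using lborel_affine_euclidean[of c 0] by simp
  also have "(\<Prod>j\<in>Basis. \<bar>c j\<bar>) = 1"
    using c(2) by (intro prod.neutral) auto
  finally show ?thesis
    by (simp add: density_1)
qed

text \<open>Substitute \<open>flip z\<close> for \<open>z\<close>: Lebesgue measure is invariant,
  and the Gaussian density depends on \<open>norm z\<close> only.\<close>

lemma smoothed_kernel_flip:
  assumes nrm: "\<And>x. nrm (flip x) = nrm x" and [measurable]: "nrm \<in> borel_measurable borel"
  shows "smoothed_kernel p nrm e (flip y) = smoothed_kernel p nrm e y"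
proof -
  have *: "smoothed_kernel p nrm e y = (LINT z|lborel. gauss_density z *\<^sub>R (nrm (y + e *\<^sub>R z) powr - p))" for y
    unfolding smoothed_kernel_def std_gaussian_def
    by (subst integral_density) (auto simp: less_imp_le[OF gauss_density_pos])
  have "smoothed_kernel p nrm e (flip y)
    = (LINT z|distr lborel borel flip. gauss_density z *\<^sub>R (nrm (flip y + e *\<^sub>R z) powr - p))"
    by (simp add: * lborel_distr_flip)
  also have "\<dots> = (LINT z|lborel. gauss_density (flip z) *\<^sub>R (nrm (flip y + e *\<^sub>R flip z) powr - p))"
    by (rule integral_distr) measurable
  also have "\<dots> = smoothed_kernel p nrm e y"
    by (simp add: * nrm gauss_density_eq norm_flip flip: flip_affine)
  finally show ?thesis .
qed

lemma char_functional_flip: "char_functional M (\<lambda>\<omega>. flip (X \<omega>)) \<xi> = char_functional M X (flip \<xi>)"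
  by (simp add: char_functional_def inner_flip)

section \<open>Comparison of the smoothed expectations\<close>

text \<open>\<open>X\<close> and its reflection have the same smoothed expectation, so twice that of
  \<open>X\<close> is the integral of the two characteristic functionals on the right of
  \<open>char\<close>. Both measures in the representation are non-negative, hence
  \<open>char\<close> may be integrated.\<close>

lemma expectation_smoothed_kernel_mono:
  fixes X :: "'a \<Rightarrow> real ^ ('k::finite + 'm::finite)" and Y :: "'b \<Rightarrow> real ^ ('k + 'm)"
  assumes p: "0 < p" "p < real CARD('k + 'm)" and e: "0 < e"
    and M: "prob_space M" and X[measurable]: "X \<in> borel_measurable M"
    and N: "prob_space N" and Y[measurable]: "Y \<in> borel_measurable N"
    and hom: "homogeneous_space nrm" and emb: "embeds_in_L_neg p nrm"
    and nrm: "\<And>x. nrm (flip x) = nrm x"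
    and char: "\<And>\<xi>. 2 * Re (char_functional N Y \<xi>)
      \<le> Re (char_functional M X \<xi>) + Re (char_functional M X (flip \<xi>))"
  shows "integrable M (\<lambda>\<omega>. smoothed_kernel p nrm e (X \<omega>))"
    and "integrable N (\<lambda>\<omega>. smoothed_kernel p nrm e (Y \<omega>))"
    and "(LINT \<omega>|N. smoothed_kernel p nrm e (Y \<omega>)) \<le> (LINT \<omega>|M. smoothed_kernel p nrm e (X \<omega>))"
proof -
  obtain \<gamma> :: "(real ^ ('k + 'm)) measure" where
    \<gamma>: "sets \<gamma> = sets (restrict_space borel (sphere 0 1))" "finite_measure \<gamma>"
    and "\<And>\<phi>. schwartz \<phi> \<Longrightarrow> (CLINT x | lborel. (nrm x powr (- p)) *\<^sub>R \<phi> x) =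
           (CLINT \<xi> | \<gamma>. CLINT t | lborel. (\<bar>t\<bar> powr (p - 1)) *\<^sub>R fourier \<phi> (t *\<^sub>R \<xi>))"
    using emb unfolding embeds_in_L_neg_def by blast
  note repr = smoothed_kernel_embedding[OF p hom e this]
  note EX = expectation_smoothed_kernel[OF p(1) e \<gamma> repr M X]
  note EY = expectation_smoothed_kernel[OF p(1) e \<gamma> repr N Y]
  have flipX: "(\<lambda>\<omega>. flip (X \<omega>)) \<in> borel_measurable M"
    by measurable
  note EF = expectation_smoothed_kernel[OF p(1) e \<gamma> repr M flipX, unfolded char_functional_flip]
  show "integrable M (\<lambda>\<omega>. smoothed_kernel p nrm e (X \<omega>))"
    by (rule EX(1))
  show "integrable N (\<lambda>\<omega>. smoothed_kernel p nrm e (Y \<omega>))"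
    by (rule EY(1))
  have "nrm \<in> borel_measurable borel"
    using hom by (intro borel_measurable_continuous_onI) (simp add: homogeneous_space_def)
  note fl = smoothed_kernel_flip[OF nrm this, of p e]
  have "2 * (LINT \<omega>|N. smoothed_kernel p nrm e (Y \<omega>))
    = (LINT \<xi>|\<gamma>. 2 * (LINT t|gamma_measure p e. Re (char_functional N Y (t *\<^sub>R \<xi>))))"
    by (simp add: EY(2))
  also have "\<dots> \<le> (LINT \<xi>|\<gamma>. (LINT t|gamma_measure p e. Re (char_functional M X (t *\<^sub>R \<xi>)))
    + (LINT t|gamma_measure p e. Re (char_functional M X (flip (t *\<^sub>R \<xi>)))))"
  proof (intro integral_mono Bochner_Integration.integrable_add integrable_mult_right EX EY EF)
    fix \<xi>
    have "2 * (LINT t|gamma_measure p e. Re (char_functional N Y (t *\<^sub>R \<xi>)))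
      = (LINT t|gamma_measure p e. 2 * Re (char_functional N Y (t *\<^sub>R \<xi>)))"
      by simp
    also have "\<dots> \<le> (LINT t|gamma_measure p e. Re (char_functional M X (t *\<^sub>R \<xi>)) + Re (char_functional M X (flip (t *\<^sub>R \<xi>))))"
      by (intro integral_mono Bochner_Integration.integrable_add integrable_mult_right EX EY EF char)
    also have "\<dots> = (LINT t|gamma_measure p e. Re (char_functional M X (t *\<^sub>R \<xi>)))
      + (LINT t|gamma_measure p e. Re (char_functional M X (flip (t *\<^sub>R \<xi>))))"
      by (intro Bochner_Integration.integral_add EX EF)
    finally show "2 * (LINT t|gamma_measure p e. Re (char_functional N Y (t *\<^sub>R \<xi>)))
      \<le> (LINT t|gamma_measure p e. Re (char_functional M X (t *\<^sub>R \<xi>)))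
      + (LINT t|gamma_measure p e. Re (char_functional M X (flip (t *\<^sub>R \<xi>))))" .
  qed
  also have "\<dots> = (LINT \<omega>|M. smoothed_kernel p nrm e (X \<omega>)) + (LINT \<omega>|M. smoothed_kernel p nrm e (flip (X \<omega>)))"
    using Bochner_Integration.integral_add[OF EX(3) EF(3)] by (simp only: EX(2) EF(2))
  finally show "(LINT \<omega>|N. smoothed_kernel p nrm e (Y \<omega>)) \<le> (LINT \<omega>|M. smoothed_kernel p nrm e (X \<omega>))"
    by (simp add: fl)
qed

section \<open>Removing the smoothing\<close>

theorem theorem5:
  fixes M :: "'a measure" and N :: "'b measure"
    and X :: "'a \<Rightarrow> real ^ ('k::finite + 'm::finite)"
    and Y :: "'b \<Rightarrow> real ^ ('k + 'm)"
    and nrm :: "real ^ ('k + 'm) \<Rightarrow> real"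
    and p q :: real
  assumes "0 < q" "q \<le> 2"
    and "prob_space M" and "symmetric_stable q M X"
    and "prob_space N" and "symmetric_stable q N Y"
    and "distr N borel (\<lambda>\<omega>. fst_coords (Y \<omega>)) = distr M borel (\<lambda>\<omega>. fst_coords (X \<omega>))"
    and "distr N borel (\<lambda>\<omega>. snd_coords (Y \<omega>)) = distr M borel (\<lambda>\<omega>. snd_coords (X \<omega>))"
    and "\<And>i j. prob_space.indep_var N borel (\<lambda>\<omega>. Y \<omega> $ Inl i) borel (\<lambda>\<omega>. Y \<omega> $ Inr j)"
    and "0 < p" "p < real CARD('k + 'm)"
    and "homogeneous_space nrm" and "embeds_in_L_neg p nrm"
    and "\<And>u v. nrm (join_coords u v) = nrm (join_coords u (- v))"
  shows "(\<integral>\<^sup>+ \<omega>. neg_power p (nrm (X \<omega>)) \<partial>M) \<ge> (\<integral>\<^sup>+ \<omega>. neg_power p (nrm (Y \<omega>)) \<partial>N)"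
proof (cases "(\<integral>\<^sup>+ \<omega>. neg_power p (nrm (X \<omega>)) \<partial>M) = \<infinity>")
  \<comment> \<open>With an infinite expectation for \<open>X\<close> there is nothing to prove; a
    finite one gives the majorant for dominated convergence.\<close>
  case False
  note q = assms(1,2) and p = assms(10,11) and hom = assms(12)
  have X[measurable]: "X \<in> borel_measurable M" and Y[measurable]: "Y \<in> borel_measurable N"
    using assms(4,6) by (auto simp: symmetric_stable_def)
  obtain m L where mL: "0 < m" "0 < L" "\<And>x. m * norm x \<le> nrm x" "\<And>x. nrm x \<le> L * norm x"
    using homogeneous_space_bounds[OF hom] by blast
  note [measurable] = nrm_measurable[OF p hom mL]
  have nrm_flip: "nrm (flip x) = nrm x" for x
    using assms(14)[of "fst_coords x" "snd_coords x"] by (simp add: flip_def join_fst_snd)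
  \<comment> \<open>The functional of \<open>Y\<close> factorises over the blocks, and equality of
    the block laws rewrites each factor in terms of \<open>X\<close>.\<close>
  have char: "2 * Re (char_functional N Y \<xi>) \<le> Re (char_functional M X \<xi>) + Re (char_functional M X (flip \<xi>))" for \<xi>
  proof -
    let ?u = "fst_coords \<xi>" and ?v = "snd_coords \<xi>"
    obtain s where s: "\<And>l. in_Lq q (s l)" and charY: "\<And>\<xi>. char_functional N Y \<xi> =
           complex_of_real (exp (- Lq_norm_pow q (\<lambda>x. \<Sum>i\<in>UNIV. \<xi> $ i * s i x)))"
      using assms(6) by (auto simp: symmetric_stable_def)
    have "char_functional N Y \<xi> = char_functional N Y (join_coords ?u 0) * char_functional N Y (join_coords 0 ?v)"
      using stable_block_independence[OF q assms(5) s charY assms(9), of ?u ?v] by (simp add: join_fst_snd)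
    also have "\<dots> = char_functional M X (join_coords ?u 0) * char_functional M X (join_coords 0 ?v)"
      by (simp only: char_functional_join[OF X] char_functional_join[OF Y] assms(7,8))
    finally show ?thesis
      using stable_char_functional_average_ge[OF q assms(4), of ?u ?v]
      by (simp add: join_fst_snd flip_def)
  qed
  define e where "e = (\<lambda>k. inverse (real (Suc k)))"
  have e: "e \<longlonglongrightarrow> 0" "\<And>k. 0 < e k"
    unfolding e_def by (rule LIMSEQ_inverse_real_of_nat) simp
  note mono = expectation_smoothed_kernel_mono[OF p e(2) assms(3) X assms(5) Y hom assms(13) nrm_flip char]
  \<comment> \<open>For each fixed width the smoothed expectations are finite, so the real
    comparison carries over to \<open>ennreal\<close>.\<close>
  have le: "(\<integral>\<^sup>+ \<omega>. gauss_mean p nrm (e k) (Y \<omega>) \<partial>N) \<le> (\<integral>\<^sup>+ \<omega>. gauss_mean p nrm (e k) (X \<omega>) \<partial>M)" for k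
    unfolding gauss_mean_eq_smoothed_kernel[OF p hom e(2)]
    using mono(3)[of k]
    by (simp add: nn_integral_eq_integral mono(1,2) smoothed_kernel_nonneg ennreal_leI)
  have [measurable]: "gauss_mean p nrm (e k) \<in> borel_measurable borel" for k
  proof -
    interpret prob_space "std_gaussian :: (real ^ ('k + 'm)) measure" by (rule prob_space_std_gaussian)
    show ?thesis
      unfolding gauss_mean_def by measurable
  qed
  have lim: "(\<lambda>k. \<integral>\<^sup>+ \<omega>. gauss_mean p nrm (e k) (X \<omega>) \<partial>M) \<longlonglongrightarrow> (\<integral>\<^sup>+ \<omega>. neg_power p (nrm (X \<omega>)) \<partial>M)"
  proof -
    obtain C where C: "0 < C" "\<And>e y. 0 < e \<Longrightarrow> gauss_mean p nrm e y \<le> ennreal C * neg_power p (nrm y)"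
      using gauss_mean_bound[OF p hom mL] by blast
    show ?thesis
    proof (rule nn_integral_dominated_convergence[where w = "\<lambda>\<omega>. ennreal C * neg_power p (nrm (X \<omega>))"])
      show "(\<integral>\<^sup>+ \<omega>. ennreal C * neg_power p (nrm (X \<omega>)) \<partial>M) < \<infinity>"
        using False by (subst nn_integral_cmult) (auto simp: ennreal_mult_less_top less_top)
      show "AE \<omega> in M. gauss_mean p nrm (e k) (X \<omega>) \<le> ennreal C * neg_power p (nrm (X \<omega>))" for k
        using C(2)[OF e(2)] by simp
      \<comment> \<open>Finiteness forces \<open>X \<omega> \<noteq> 0\<close> almost surely, the
        condition for pointwise convergence in \<open>gauss_mean_tendsto\<close>.\<close>
      have "AE \<omega> in M. neg_power p (nrm (X \<omega>)) \<noteq> \<infinity>"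
        using False by (intro nn_integral_PInf_AE) auto
      then show "AE \<omega> in M. (\<lambda>k. gauss_mean p nrm (e k) (X \<omega>)) \<longlonglongrightarrow> neg_power p (nrm (X \<omega>))"
      proof eventually_elim
        case (elim \<omega>)
        have "nrm 0 = 0"
          using mL(3,4)[of 0] by simp
        then have "X \<omega> \<noteq> 0"
          using elim by (auto simp: neg_power_def)
        then show ?case
          by (rule gauss_mean_tendsto[OF p hom mL e])
      qed
    qed measurable
  qed
  \<comment> \<open>Finiteness for \<open>Y\<close> is not known in advance, so only Fatou's lemma
    is available on this side.\<close>
  have "(\<integral>\<^sup>+ \<omega>. neg_power p (nrm (Y \<omega>)) \<partial>N) \<le> (\<integral>\<^sup>+ \<omega>. liminf (\<lambda>k. gauss_mean p nrm (e k) (Y \<omega>)) \<partial>N)"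
    by (intro nn_integral_mono neg_power_nrm_le_liminf_gauss_mean[OF p hom mL e(1)])
  also have "\<dots> \<le> liminf (\<lambda>k. \<integral>\<^sup>+ \<omega>. gauss_mean p nrm (e k) (Y \<omega>) \<partial>N)"
    by (rule nn_integral_liminf) measurable
  also have "\<dots> \<le> liminf (\<lambda>k. \<integral>\<^sup>+ \<omega>. gauss_mean p nrm (e k) (X \<omega>) \<partial>M)"
    by (intro Liminf_mono always_eventually allI le)
  also have "\<dots> = (\<integral>\<^sup>+ \<omega>. neg_power p (nrm (X \<omega>)) \<partial>M)"
    by (rule lim_imp_Liminf[OF _ lim]) simp
  finally show ?thesis .
qed simp

end
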